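(* Let $M$ be a locally finite subset of a Hilbert space. Then for every infinite dimensional Banach space $X$ there exists a Lipschitz embedding of $M$ into $X$.
   Context: A metric space is called locally finite if all balls in it have finitely many elements; a subset of a Hilbert space is regarded as a metric space with the metric induced by the norm. A mapping $f:A\to B$ between metric spaces $(A,d_A)$ and $(B,d_B)$ is called Lipschitz if there is a constant $0\le L<\infty$ with $d_B(f(x),f(y))\le L\, d_A(x,y)$ for all $x,y\in A$. A Lipschitz mapping is called a Lipschitz embedding if it is one-to-one and its inverse, defined as a mapping from the image of $f$ into $A$, is also Lipschitz. *)

theory Defs
  imports "HOL-Analysis.Analysis"
begin

(* A subset M carries the metric induced from the ambient space, so the balls of M are the
   traces on M of the ambient balls centred at points of M. *)
definition locally_finite :: "'a::metric_space set \<Rightarrow> bool" where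
  "locally_finite M \<longleftrightarrow> (\<forall>x\<in>M. \<forall>r. finite (cball x r \<inter> M))"

(* The map is only relevant on A; the inverse lives on the image f ` A, with the metric of the
   codomain. *)
definition lipschitz_embedding_on ::
    "'a::metric_space set \<Rightarrow> ('a \<Rightarrow> 'b::metric_space) \<Rightarrow> bool" where
  "lipschitz_embedding_on A f \<longleftrightarrow>
     (\<exists>L. L-lipschitz_on A f) \<and> inj_on f A \<and>
     (\<exists>L. L-lipschitz_on (f ` A) (inv_into A f))"

definition finite_dimensional :: "'a::real_vector set \<Rightarrow> bool" where
  "finite_dimensional S \<longleftrightarrow> (\<exists>B. finite B \<and> span B = S)"

end

theory Submission
  imports Defs "HOL-Probability.Probability" "Jordan_Normal_Form.Determinant"
begin

text \<open>
  Infinite dimensional normed spaces contain uniformly isomorphic copies of Euclidean spaces. Only a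
  weak form of Dvoretzky's theorem with a large constant is needed, for finitely many vectors at a
  time, and it comes from a random Gaussian map. By a Dvoretzky--Rogers argument there are
  \<open>x\<^sub>1, \<dots>, x\<^sub>m\<close> of norm at least \<open>1/4\<close> whose linear combinations are bounded by the
  Euclidean norm of the coefficients. The mean \<open>A\<close> of \<open>\<parallel>\<Sum> g\<^sub>i x\<^sub>i\<parallel>\<close> tends to
  infinity with \<open>m\<close>, while the variance of \<open>\<parallel>u + \<Sum> g\<^sub>i x\<^sub>i\<parallel>\<close> is bounded by an absolute
  constant. So the Gaussian map \<open>T\<close>, normalised by \<open>A\<close>, satisfies \<open>\<parallel>T z\<parallel> \<le> 2 \<parallel>z\<parallel>\<close> and
  \<open>\<parallel>u + T z\<parallel> \<ge> \<parallel>z\<parallel> / 2\<close> simultaneously for any finite set of pairs \<open>(u, z)\<close>, by Chebyshev's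
  inequality alone. The shifts \<open>u\<close> replace the usual passage to subspaces of finite codimension.

  With a dyadic partition of unity \<open>\<phi>\<^sub>k\<close> the embedding is \<open>f x = \<Sum> \<phi>\<^sub>k(\<parallel>x\<parallel>) T\<^sub>k x\<close>, where
  \<open>T\<^sub>k\<close> is chosen after \<open>T\<^sub>0, \<dots>, T\<^sub>k\<^sub>-\<^sub>1\<close>. Since \<open>\<Sum> (\<phi>\<^sub>k(\<parallel>x\<parallel>) x - \<phi>\<^sub>k(\<parallel>y\<parallel>) y) = x - y\<close>
  has at most four nonzero terms, one of them has norm at least \<open>\<parallel>x - y\<parallel> / 4\<close>; it makes the partial
  sum of \<open>f x - f y\<close> large, and each of the at most three later terms costs only a factor \<open>5\<close>.
\<close>

no_notation scalar_prod (infix "\<bullet>" 70)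

section \<open>Determinants and orthonormal columns\<close>

text \<open>Wraps the library determinant so that the entries are a plain function of two indices;
  sums, scalings and substitutions of entries then carry no matrix dimensions.\<close>

definition detf :: "nat \<Rightarrow> (nat \<Rightarrow> nat \<Rightarrow> real) \<Rightarrow> real" where
  "detf n A = Determinant.det (mat n n (\<lambda>(i, j). A i j))"

lemma detf_cong:
  assumes "\<And>i j. i < n \<Longrightarrow> j < n \<Longrightarrow> A i j = B i j"
  shows "detf n A = detf n B"
  unfolding detf_def by (intro arg_cong[of _ _ Determinant.det] eq_matI) (auto simp: assms)

lemma detf_mult: "detf n (\<lambda>i j. \<Sum>k<n. A i k * B k j) = detf n A * detf n B"
proof -
  have "mat n n (\<lambda>(i, j). \<Sum>k<n. A i k * B k j) = mat n n (\<lambda>(i, j). A i j) * mat n n (\<lambda>(i, j). B i j)"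
    by (rule eq_matI) (auto simp: scalar_prod_def lessThan_atLeast0)
  then show ?thesis
    unfolding detf_def by (simp add: det_mult[of _ n])
qed

lemma detf_expand:
  "detf n A = (\<Sum>p | p permutes {0..<n}. signof p * (\<Prod>i = 0..<n. A i (p i)))"
  unfolding detf_def
  by (subst det_def'[of _ n]) (auto intro!: sum.cong prod.cong simp: permutes_in_image)

text \<open>Each Leibniz term takes exactly one entry from every column, so it picks up each factor
  \<open>d j\<close> once.\<close>

lemma detf_scale_columns: "detf n (\<lambda>i j. A i j * d j) = detf n A * (\<Prod>j<n. d j)"
proof -
  have "(\<Prod>i = 0..<n. A i (p i) * d (p i)) = (\<Prod>i = 0..<n. A i (p i)) * (\<Prod>j<n. d j)"
    if "p permutes {0..<n}" for p
    using prod.permute[OF that, of d] by (simp add: prod.distrib comp_def lessThan_atLeast0)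
  then show ?thesis
    by (simp add: detf_expand sum_distrib_right mult.assoc)
qed

lemma detf_diagonal: "detf n (\<lambda>i j. if i = j then d j else 0) = (\<Prod>j<n. d j)"
proof -
  have "mat n n (\<lambda>(i, j). if i = j then 1 else 0) = (1\<^sub>m n :: real mat)"
    by (rule eq_matI) auto
  then have "detf n (\<lambda>i j. if i = j then 1 else 0) = 1"
    by (simp add: detf_def)
  then show ?thesis
    using detf_scale_columns[of n "\<lambda>i j. if i = j then 1 else 0" d]
    by (simp add: if_distrib[of "\<lambda>x. x * _"] cong: if_cong)
qed

text \<open>The Leibniz formula has \<open>fact n\<close> terms of size at most
  \<open>K ^ n\<close>. This crude bound serves to make a supremum of determinants finite.\<close>

lemma abs_detf_le:
  assumes "\<And>i j. i < n \<Longrightarrow> j < n \<Longrightarrow> \<bar>A i j\<bar> \<le> K"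
  shows "\<bar>detf n A\<bar> \<le> fact n * K ^ n"
proof -
  have "\<bar>detf n A\<bar> \<le> (\<Sum>p | p permutes {0..<n}. \<bar>signof p * (\<Prod>i = 0..<n. A i (p i))\<bar>)"
    unfolding detf_expand by (rule sum_abs)
  also have "\<dots> \<le> (\<Sum>p | p permutes {0..<n}. K ^ n)"
  proof (rule sum_mono)
    fix p assume "p \<in> {p. p permutes {0..<n}}"
    then have "(\<Prod>i = 0..<n. \<bar>A i (p i)\<bar>) \<le> (\<Prod>i = 0..<n. K)"
      by (intro prod_mono) (auto intro!: assms simp: permutes_in_image)
    then show "\<bar>signof p * (\<Prod>i = 0..<n. A i (p i))\<bar> \<le> K ^ n"
      by (simp add: abs_mult abs_prod sign_def)
  qed
  also have "\<dots> = fact n * K ^ n"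
    by (simp add: card_permutations[of _ n])
  finally show ?thesis .
qed

text \<open>The transpose of \<open>q\<close> times \<open>q\<close> is the identity, so the
  determinant squares to 1.\<close>

lemma detf_orthogonal:
  assumes "\<And>i j. i < n \<Longrightarrow> j < n \<Longrightarrow> (\<Sum>k<n. q k i * q k j) = (if i = j then 1 else 0)"
  shows "\<bar>detf n q\<bar> = 1"
proof -
  have tr: "detf n (\<lambda>i j. q j i) = detf n q"
    unfolding detf_def by (subst Determinant.det_transpose[of _ n, symmetric])
      (auto intro!: arg_cong[of _ _ Determinant.det] eq_matI)
  have "detf n q * detf n q = detf n (\<lambda>i j. \<Sum>k<n. q k i * q k j)"
    by (subst (1) tr[symmetric]) (rule detf_mult[symmetric])
  also have "\<dots> = detf n (\<lambda>i j. if i = j then 1 else 0)"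
    by (rule detf_cong) (rule assms)
  also have "\<dots> = 1" using detf_diagonal[of n "\<lambda>_. 1"] by simp
  finally have "\<bar>detf n q\<bar>\<^sup>2 = 1" by (simp add: power2_eq_square)
  then show ?thesis
    by (metis power2_eq_1_iff abs_minus_cancel abs_one abs_abs)
qed

text \<open>\<open>q\<close> holds the vectors as columns: \<open>q k i\<close> is the \<open>k\<close>-th coordinate of the \<open>i\<close>-th vector.\<close>

definition orthonormal_cols :: "nat \<Rightarrow> nat \<Rightarrow> (nat \<Rightarrow> nat \<Rightarrow> real) \<Rightarrow> bool" where
  "orthonormal_cols n r q \<longleftrightarrow>
     (\<forall>i<r. \<forall>j<r. (\<Sum>k<n. q k i * q k j) = (if i = j then 1 else 0))"

section \<open>Completing orthonormal systems\<close>

lemma orthonormal_cols_Suc: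
  assumes "orthonormal_cols n r q"
    and "(\<Sum>k<n. v k * v k) = 1" "\<And>j. j < r \<Longrightarrow> (\<Sum>k<n. v k * q k j) = 0"
  shows "orthonormal_cols n (Suc r) (\<lambda>k i. if i = r then v k else q k i)"
  using assms unfolding orthonormal_cols_def less_Suc_eq by (auto simp: mult.commute)

text \<open>Some standard basis vector has a nonzero component orthogonal to the given vectors, since
  the squared norms of the projections of the basis vectors add up to \<open>r < n\<close>.\<close>

lemma orthonormal_cols_extend1:
  assumes q: "orthonormal_cols n r q" and "r < n"
  obtains v where "(\<Sum>k<n. v k * v k) = 1" "\<And>j. j < r \<Longrightarrow> (\<Sum>k<n. v k * q k j) = 0"
proof -
  have qq: "(\<Sum>k<n. q k i * q k j) = (if i = j then 1 else 0)" if "i < r" "j < r" for i j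
    using q that by (simp add: orthonormal_cols_def)
  have "(\<Sum>k<n. \<Sum>i<r. (q k i)\<^sup>2) = (\<Sum>i<r. \<Sum>k<n. (q k i)\<^sup>2)" by (rule sum.swap)
  also have "\<dots> = r" by (simp add: power2_eq_square qq)
  finally have tot: "(\<Sum>k<n. \<Sum>i<r. (q k i)\<^sup>2) = real r" .
  have "\<exists>l<n. (\<Sum>i<r. (q l i)\<^sup>2) < 1"
  proof (rule ccontr)
    assume "\<not> ?thesis"
    then have "(\<Sum>k<n. 1) \<le> (\<Sum>k<n. \<Sum>i<r. (q k i)\<^sup>2)" by (intro sum_mono) auto
    then show False using tot \<open>r < n\<close> by simp
  qed
  then obtain l where l: "l < n" "(\<Sum>i<r. (q l i)\<^sup>2) < 1" by blast
  define w where "w k = (if k = l then 1 else 0) - (\<Sum>i<r. q l i * q k i)" for k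
  have wq: "(\<Sum>k<n. w k * q k j) = 0" if "j < r" for j
  proof -
    have "(\<Sum>k<n. w k * q k j) = (\<Sum>k<n. (if k = l then q k j else 0)) - (\<Sum>k<n. \<Sum>i<r. q l i * (q k i * q k j))"
      unfolding w_def left_diff_distrib sum_subtractf sum_distrib_right
      by (intro arg_cong2[of _ _ _ _ "(-)"] sum.cong) (auto simp: mult_ac)
    also have "(\<Sum>k<n. \<Sum>i<r. q l i * (q k i * q k j)) = (\<Sum>i<r. q l i * (\<Sum>k<n. q k i * q k j))"
      by (subst sum.swap) (simp add: sum_distrib_left)
    also have "\<dots> = (\<Sum>i<r. if i = j then q l i else 0)"
      using that by (intro sum.cong) (auto simp: qq)
    finally show ?thesis using l that by simp
  qed
  \<comment> \<open>Because \<open>w\<close> is orthogonal to all columns, the projection part of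
    one factor drops out. The squared norm is the single coordinate \<open>w l\<close>, which is
    positive by the choice of \<open>l\<close>.\<close>
  have "(\<Sum>k<n. w k * w k) = (\<Sum>k<n. (if k = l then w k else 0)) - (\<Sum>k<n. \<Sum>i<r. q l i * (w k * q k i))"
    unfolding sum_subtractf[symmetric]
  proof (intro sum.cong refl)
    fix k
    have "w k * w k = w k * ((if k = l then 1 else 0) - (\<Sum>i<r. q l i * q k i))"
      by (simp add: w_def)
    also have "\<dots> = (if k = l then w k else 0) - (\<Sum>i<r. q l i * (w k * q k i))"
      by (simp add: right_diff_distrib sum_distrib_left mult_ac)
    finally show "w k * w k = \<dots>" .
  qed
  also have "(\<Sum>k<n. \<Sum>i<r. q l i * (w k * q k i)) = (\<Sum>i<r. q l i * (\<Sum>k<n. w k * q k i))"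
    by (subst sum.swap) (simp add: sum_distrib_left)
  also have "\<dots> = 0" by (simp add: wq)
  finally have ww: "(\<Sum>k<n. w k * w k) = 1 - (\<Sum>i<r. (q l i)\<^sup>2)"
    using l by (simp add: w_def power2_eq_square)
  define s where "s = sqrt (\<Sum>k<n. w k * w k)"
  have s: "s > 0" "s * s = (\<Sum>k<n. w k * w k)"
    using ww l by (auto simp: s_def)
  show ?thesis
  proof
    show "(\<Sum>k<n. (w k / s) * (w k / s)) = 1"
      using s(1) by (simp add: sum_divide_distrib[symmetric] s(2)[symmetric])
    show "(\<Sum>k<n. (w k / s) * q k j) = 0" if "j < r" for j
      using wq[OF that] by (simp add: sum_divide_distrib[symmetric])
  qed
qed

lemma orthonormal_cols_extend:
  assumes "orthonormal_cols n r q" "r \<le> n"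
  obtains q' where "orthonormal_cols n n q'" "\<And>k i. i < r \<Longrightarrow> q' k i = q k i"
proof -
  have "r + d \<le> n \<Longrightarrow> \<exists>q'. orthonormal_cols n (r + d) q' \<and> (\<forall>k. \<forall>i<r. q' k i = q k i)" for d
  proof (induction d)
    case 0
    then show ?case using assms by auto
  next
    case (Suc d)
    then obtain q' where q': "orthonormal_cols n (r + d) q'" "\<forall>k. \<forall>i<r. q' k i = q k i" by auto
    obtain v where "(\<Sum>k<n. v k * v k) = 1" "\<And>j. j < r + d \<Longrightarrow> (\<Sum>k<n. v k * q' k j) = 0"
      using orthonormal_cols_extend1[OF q'(1)] Suc.prems by auto
    from orthonormal_cols_Suc[OF q'(1) this] show ?case
      using q'(2) by (intro exI[of _ "\<lambda>k i. if i = r + d then v k else q' k i"]) auto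
  qed
  from this[of "n - r"] that assms(2) show ?thesis by auto
qed

text \<open>On expanding the square, orthonormality removes the mixed terms: the columns define an
  isometry from Euclidean \<open>r\<close>-space into \<open>n\<close>-space.\<close>

lemma orthonormal_cols_norm:
  assumes "orthonormal_cols n r q"
  shows "(\<Sum>k<n. (\<Sum>i<r. q k i * a i)\<^sup>2) = (\<Sum>i<r. (a i)\<^sup>2)"
proof -
  have "(\<Sum>k<n. (\<Sum>i<r. q k i * a i)\<^sup>2) = (\<Sum>k<n. \<Sum>i<r. \<Sum>j<r. (a i * a j) * (q k i * q k j))"
    by (simp add: power2_eq_square sum_product mult_ac)
  also have "\<dots> = (\<Sum>i<r. \<Sum>j<r. (a i * a j) * (\<Sum>k<n. q k i * q k j))"
  proof -
    have "(\<Sum>k<n. \<Sum>i<r. \<Sum>j<r. (a i * a j) * (q k i * q k j))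
      = (\<Sum>i<r. \<Sum>k<n. \<Sum>j<r. (a i * a j) * (q k i * q k j))" by (rule sum.swap)
    also have "\<dots> = (\<Sum>i<r. \<Sum>j<r. \<Sum>k<n. (a i * a j) * (q k i * q k j))"
      by (rule sum.cong[OF refl], rule sum.swap)
    finally show ?thesis by (simp add: sum_distrib_left)
  qed
  also have "\<dots> = (\<Sum>i<r. \<Sum>j<r. if j = i then (a i)\<^sup>2 else 0)"
    using assms by (intro sum.cong) (auto simp: orthonormal_cols_def power2_eq_square)
  finally show ?thesis by simp
qed

section \<open>The Dvoretzky--Rogers lemma\<close>

text \<open>The linear map from Euclidean \<open>n\<close>-space that sends the standard basis to
  \<open>x\<close> has operator norm at most 1.\<close>

definition contractive :: "nat \<Rightarrow> (nat \<Rightarrow> 'a::real_normed_vector) \<Rightarrow> bool" where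
  "contractive n x \<longleftrightarrow> (\<forall>a. norm (\<Sum>i<n. a i *\<^sub>R x i) \<le> sqrt (\<Sum>i<n. (a i :: real)\<^sup>2))"

lemma contractiveD: "contractive n x \<Longrightarrow> norm (\<Sum>i<n. a i *\<^sub>R x i) \<le> sqrt (\<Sum>i<n. (a i)\<^sup>2)"
  by (simp add: contractive_def)

section \<open>Independent vectors with bounded coordinates\<close>

text \<open>If the distance were 0, a sequence in the span would converge to \<open>y\<close>. The
  coordinate bound makes its coefficients Cauchy, hence convergent in the reals, and their limits
  would represent \<open>y\<close> in the span.\<close>

lemma dist_from_coordinate_subspace:
  fixes b :: "nat \<Rightarrow> 'a::real_normed_vector"
  assumes K: "\<And>a i. i < n \<Longrightarrow> \<bar>a i\<bar> \<le> K * norm (\<Sum>j<n. a j *\<^sub>R b j)"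
    and y: "\<And>a. y \<noteq> (\<Sum>j<n. a j *\<^sub>R b j)"
  shows "\<exists>d>0. \<forall>a. d \<le> norm (y - (\<Sum>j<n. a j *\<^sub>R b j))"
proof (rule ccontr)
  assume "\<not> ?thesis"
  then have "\<exists>a. norm (y - (\<Sum>j<n. a j *\<^sub>R b j)) < d" if "0 < d" for d :: real
    using that by (meson not_le)
  then have "\<exists>a. norm (y - (\<Sum>j<n. a j *\<^sub>R b j)) < inverse (real (Suc k))" for k
    by simp
  then obtain a where a: "\<And>k. norm (y - (\<Sum>j<n. a k j *\<^sub>R b j)) < inverse (real (Suc k))"
    by metis
  define v where "v k = (\<Sum>j<n. a k j *\<^sub>R b j)" for k
  have "(\<lambda>k. y - v k) \<longlonglongrightarrow> 0"
  proof (rule Lim_null_comparison)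
    show "\<forall>\<^sub>F k in sequentially. norm (y - v k) \<le> inverse (real (Suc k))"
      using a by (intro always_eventually allI less_imp_le) (simp add: v_def)
  qed (rule LIMSEQ_inverse_real_of_nat)
  from tendsto_diff[OF tendsto_const[of y] this] have v: "v \<longlonglongrightarrow> y" by simp
  have "\<exists>c. (\<lambda>k. a k i) \<longlonglongrightarrow> c" if "i < n" for i
  proof -
    have "Cauchy (\<lambda>k. a k i)"
    proof (rule metric_CauchyI)
      fix e :: real assume "0 < e"
      then have e': "0 < e / (\<bar>K\<bar> + 1)" by simp
      from LIMSEQ_imp_Cauchy[OF v] obtain M where M: "\<And>p q. p \<ge> M \<Longrightarrow> q \<ge> M \<Longrightarrow> dist (v p) (v q) < e / (\<bar>K\<bar> + 1)"
        using metric_CauchyD[OF _ e'] by blast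
      have "dist (a p i) (a q i) < e" if "p \<ge> M" "q \<ge> M" for p q
      proof -
        have "dist (a p i) (a q i) \<le> K * norm (v p - v q)"
          using K[of i "\<lambda>j. a p j - a q j"] \<open>i < n\<close>
          by (simp add: dist_real_def v_def scaleR_diff_left sum_subtractf)
        also have "\<dots> \<le> (\<bar>K\<bar> + 1) * norm (v p - v q)"
          by (intro mult_right_mono) auto
        also have "\<dots> < (\<bar>K\<bar> + 1) * (e / (\<bar>K\<bar> + 1))"
          using M[OF that] by (intro mult_strict_left_mono) (auto simp: dist_norm)
        finally show ?thesis by simp
      qed
      then show "\<exists>M. \<forall>p\<ge>M. \<forall>q\<ge>M. dist (a p i) (a q i) < e" by blast
    qed
    then show ?thesis by (simp add: Cauchy_convergent_iff convergent_def)
  qed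
  then obtain c where c: "\<And>i. i < n \<Longrightarrow> (\<lambda>k. a k i) \<longlonglongrightarrow> c i" by metis
  have "v \<longlonglongrightarrow> (\<Sum>j<n. c j *\<^sub>R b j)"
    unfolding v_def by (intro tendsto_intros c) auto
  then show False using LIMSEQ_unique[OF v] y by blast
qed

text \<open>A vector \<open>y\<close> outside the span of the earlier ones is added. Its positive
  distance \<open>d\<close> from the span controls the new coefficient, and subtracting the multiple
  of \<open>y\<close> then controls the old ones.\<close>

lemma independent_coordinates:
  assumes inf: "\<not> finite_dimensional (UNIV :: 'a::real_normed_vector set)"
  shows "\<exists>(b :: nat \<Rightarrow> 'a) K. \<forall>a. \<forall>i<n. \<bar>a i\<bar> \<le> K * norm (\<Sum>j<n. a j *\<^sub>R b j)"
proof (induction n)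
  case 0
  then show ?case by simp
next
  case (Suc n)
  then obtain b :: "nat \<Rightarrow> 'a" and K where K: "\<And>a i. i < n \<Longrightarrow> \<bar>a i\<bar> \<le> K * norm (\<Sum>j<n. a j *\<^sub>R b j)"
    by blast
  have "span (b ` {..<n}) \<noteq> UNIV" using inf by (auto simp: finite_dimensional_def)
  then obtain y where y: "y \<notin> span (b ` {..<n})" by blast
  have "(\<Sum>j<n. a j *\<^sub>R b j) \<in> span (b ` {..<n})" for a
    by (intro span_sum span_scale span_base) auto
  then have "y \<noteq> (\<Sum>j<n. a j *\<^sub>R b j)" for a
    using y by metis
  then obtain d where d: "0 < d" "\<And>a. d \<le> norm (y - (\<Sum>j<n. a j *\<^sub>R b j))"
    using dist_from_coordinate_subspace[OF K] by metis
  define b' where "b' = b(n := y)"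
  define K' where "K' = max (1 / d) (\<bar>K\<bar> * (1 + norm y / d))"
  have "\<bar>a i\<bar> \<le> K' * norm (\<Sum>j<Suc n. a j *\<^sub>R b' j)" if "i < Suc n" for a i
  proof -
    define V where "V = (\<Sum>j<Suc n. a j *\<^sub>R b' j)"
    have V: "V = (\<Sum>j<n. a j *\<^sub>R b j) + a n *\<^sub>R y" by (simp add: V_def b'_def)
    have an: "\<bar>a n\<bar> \<le> (1 / d) * norm V"
    proof (cases "a n = 0")
      case False
      \<comment> \<open>Dividing \<open>V\<close> by \<open>a n\<close> gives \<open>y\<close> minus
        an element of the span.\<close>
      have "d \<le> norm (y - (\<Sum>j<n. (- a j / a n) *\<^sub>R b j))" by (rule d)
      also have "y - (\<Sum>j<n. (- a j / a n) *\<^sub>R b j) = (1 / a n) *\<^sub>R V"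
        using False by (simp add: V scaleR_add_right scaleR_sum_right sum_negf add.commute)
      finally show ?thesis using False d(1) by (simp add: field_simps)
    qed (use d in simp)
    have "\<bar>a i\<bar> \<le> K' * norm V"
    proof (cases "i = n")
      case True
      have "(1 / d) * norm V \<le> K' * norm V"
        by (intro mult_right_mono) (auto simp: K'_def)
      with an have "\<bar>a n\<bar> \<le> K' * norm V" by (rule order_trans)
      then show ?thesis by (simp only: True)
    next
      case False
      with that have "i < n" by simp
      then have "\<bar>a i\<bar> \<le> K * norm (\<Sum>j<n. a j *\<^sub>R b j)" by (rule K)
      also have "\<dots> \<le> \<bar>K\<bar> * norm (\<Sum>j<n. a j *\<^sub>R b j)" by (intro mult_right_mono) auto
      also have "(\<Sum>j<n. a j *\<^sub>R b j) = V - a n *\<^sub>R y" by (simp add: V)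
      also have "\<bar>K\<bar> * norm (V - a n *\<^sub>R y) \<le> \<bar>K\<bar> * (norm V + \<bar>a n\<bar> * norm y)"
        using norm_triangle_ineq4[of V "a n *\<^sub>R y"] by (intro mult_left_mono) auto
      also have "\<dots> \<le> \<bar>K\<bar> * (norm V + ((1 / d) * norm V) * norm y)"
        using an by (intro mult_left_mono add_left_mono mult_right_mono) auto
      also have "\<dots> = (\<bar>K\<bar> * (1 + norm y / d)) * norm V" by (simp add: algebra_simps)
      also have "\<dots> \<le> K' * norm V" by (intro mult_right_mono) (auto simp: K'_def)
      finally show ?thesis .
    qed
    then show ?thesis by (simp add: V_def)
  qed
  then show ?case by blast
qed

section \<open>Contractive tuples and their determinants\<close>

text \<open>The columns of \<open>q\<close> embed the coefficient spaces isometrically, and a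
  contraction composed with an isometry is a contraction.\<close>

lemma contractive_orthonormal_cols:
  assumes x: "contractive n x" and q: "orthonormal_cols n r q"
  shows "contractive r (\<lambda>i. \<Sum>k<n. q k i *\<^sub>R x k)"
  unfolding contractive_def
proof
  fix a :: "nat \<Rightarrow> real"
  have "(\<Sum>i<r. a i *\<^sub>R (\<Sum>k<n. q k i *\<^sub>R x k)) = (\<Sum>i<r. \<Sum>k<n. (q k i * a i) *\<^sub>R x k)"
    by (simp add: scaleR_sum_right mult.commute)
  also have "\<dots> = (\<Sum>k<n. \<Sum>i<r. (q k i * a i) *\<^sub>R x k)" by (rule sum.swap)
  also have "\<dots> = (\<Sum>k<n. (\<Sum>i<r. q k i * a i) *\<^sub>R x k)" by (simp add: scaleR_sum_left)
  finally have "norm (\<Sum>i<r. a i *\<^sub>R (\<Sum>k<n. q k i *\<^sub>R x k)) \<le> sqrt (\<Sum>k<n. (\<Sum>i<r. q k i * a i)\<^sup>2)"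
    using contractiveD[OF x, of "\<lambda>k. \<Sum>i<r. q k i * a i"] by simp
  then show "norm (\<Sum>i<r. a i *\<^sub>R (\<Sum>k<n. q k i *\<^sub>R x k)) \<le> sqrt (\<Sum>i<r. (a i)\<^sup>2)"
    by (simp only: orthonormal_cols_norm[OF q])
qed

text \<open>This is the step that increases the determinant: on the small coordinate subspace the doubling
  outweighs the factor \<open>sqrt (4 / 5)\<close>.\<close>

lemma contractive_double:
  fixes x :: "nat \<Rightarrow> 'a::real_normed_vector"
  assumes x: "contractive n x" and "r \<le> n"
    and small: "\<And>a :: nat \<Rightarrow> real. norm (\<Sum>i\<in>{r..<n}. a i *\<^sub>R x i) \<le> (1 / 4) * sqrt (\<Sum>i\<in>{r..<n}. (a i)\<^sup>2)"
  shows "contractive n (\<lambda>i. (sqrt (4 / 5) * (if i < r then 1 else 2)) *\<^sub>R x i)"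
  unfolding contractive_def
proof
  fix a :: "nat \<Rightarrow> real"
  have split: "(\<Sum>i<n. g i) = (\<Sum>i<r. g i) + (\<Sum>i\<in>{r..<n}. g i)" for g :: "nat \<Rightarrow> 'b::comm_monoid_add"
    using \<open>r \<le> n\<close> by (metis atLeast0LessThan le0 sum.atLeastLessThan_concat)
  define P where "P = sqrt (\<Sum>i<r. (a i)\<^sup>2)"
  define Q where "Q = sqrt (\<Sum>i\<in>{r..<n}. (a i)\<^sup>2)"
  have P: "P\<^sup>2 = (\<Sum>i<r. (a i)\<^sup>2)" and Q: "Q\<^sup>2 = (\<Sum>i\<in>{r..<n}. (a i)\<^sup>2)"
    by (simp_all add: P_def Q_def sum_nonneg)
  have S1: "norm (\<Sum>i<r. a i *\<^sub>R x i) \<le> P"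
    using contractiveD[OF x, of "\<lambda>i. if i < r then a i else 0"]
    by (simp add: split P_def)
  have S2: "norm (\<Sum>i\<in>{r..<n}. a i *\<^sub>R x i) \<le> Q / 4"
    using small[of a] by (simp add: Q_def)
  have "(\<Sum>i<n. a i *\<^sub>R ((sqrt (4 / 5) * (if i < r then 1 else 2)) *\<^sub>R x i))
    = sqrt (4 / 5) *\<^sub>R ((\<Sum>i<r. a i *\<^sub>R x i) + 2 *\<^sub>R (\<Sum>i\<in>{r..<n}. a i *\<^sub>R x i))"
    unfolding split by (simp add: scaleR_add_right scaleR_sum_right mult_ac)
  also have "norm \<dots> \<le> sqrt (4 / 5) * (P + Q / 2)"
    using norm_triangle_ineq[of "\<Sum>i<r. a i *\<^sub>R x i" "2 *\<^sub>R (\<Sum>i\<in>{r..<n}. a i *\<^sub>R x i)"] S1 S2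
    by (simp del: real_sqrt_divide)
  also have "\<dots> \<le> sqrt (P\<^sup>2 + Q\<^sup>2)"
  proof (rule real_le_rsqrt)
    \<comment> \<open>The two sides of the squared inequality differ by \<open>4 / 5\<close> of this
      square. It is the Cauchy--Schwarz inequality with \<open>1 + 1 / 4 = 5 / 4\<close>, the source
      of the factor \<open>4 / 5\<close>.\<close>
    have "0 \<le> (P / 2 - Q)\<^sup>2" by simp
    then show "(sqrt (4 / 5) * (P + Q / 2))\<^sup>2 \<le> P\<^sup>2 + Q\<^sup>2"
      unfolding power_mult_distrib by (simp add: power2_eq_square field_simps)
  qed
  finally show "norm (\<Sum>i<n. a i *\<^sub>R ((sqrt (4 / 5) * (if i < r then 1 else 2)) *\<^sub>R x i))
      \<le> sqrt (\<Sum>i<n. (a i)\<^sup>2)"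
    by (simp add: P Q split)
qed

text \<open>Among the contractive tuples in a \<open>2 m\<close>-dimensional subspace take one with almost maximal
  determinant and choose orthonormal directions greedily. If the choice gets stuck before step \<open>m\<close>,
  doubling on the orthogonal complement multiplies the determinant by at least \<open>8 / 5\<close>.\<close>

theorem Dvoretzky_Rogers:
  assumes inf: "\<not> finite_dimensional (UNIV :: 'a::real_normed_vector set)"
  obtains x :: "nat \<Rightarrow> 'a::real_normed_vector"
  where "contractive m x" "\<And>i. i < m \<Longrightarrow> 1 / 4 \<le> norm (x i)"
proof (cases "m = 0")
  case True
  then show ?thesis by (intro that[of "\<lambda>_. 0"]) (simp_all add: contractive_def)
next
  case False
  \<comment> \<open>While fewer than \<open>m\<close> directions are chosen, more than
    \<open>m\<close> remain to be doubled, against a shrinking by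
    \<open>sqrt (4 / 5) ^ n = (4 / 5) ^ m\<close>.\<close>
  define n where "n = 2 * m"
  obtain b :: "nat \<Rightarrow> 'a" and K
    where K: "\<And>a i. i < n \<Longrightarrow> \<bar>a i\<bar> \<le> K * norm (\<Sum>j<n. a j *\<^sub>R b j)"
    using independent_coordinates[OF inf, of n] by blast
  define vec where "vec A j = (\<Sum>i<n. A i j *\<^sub>R b i)" for A :: "nat \<Rightarrow> nat \<Rightarrow> real" and j
  define D where "D = {\<bar>detf n A\<bar> | A. contractive n (vec A)}"
  \<comment> \<open>Each \<open>vec A j\<close> has norm at most 1, so the coordinate bound limits
    all entries of \<open>A\<close>.\<close>
  have le: "\<bar>detf n A\<bar> \<le> fact n * \<bar>K\<bar> ^ n" if A: "contractive n (vec A)" for A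
  proof (rule abs_detf_le)
    fix i j assume "i < n" "j < n"
    have "norm (vec A j) \<le> 1"
      using contractiveD[OF A, of "\<lambda>i. if i = j then 1 else 0"] \<open>j < n\<close>
      by (simp add: if_distrib[of "\<lambda>a. a *\<^sub>R _"] if_distrib[of "\<lambda>a. a\<^sup>2"] cong: if_cong)
    then have "\<bar>K\<bar> * norm (vec A j) \<le> \<bar>K\<bar>" by (simp add: mult_left_le)
    moreover have "\<bar>A i j\<bar> \<le> K * norm (vec A j)"
      unfolding vec_def using \<open>i < n\<close> by (rule K)
    moreover have "K * norm (vec A j) \<le> \<bar>K\<bar> * norm (vec A j)"
      by (intro mult_right_mono) auto
    ultimately show "\<bar>A i j\<bar> \<le> \<bar>K\<bar>" by linarith
  qed
  then have bdd: "bdd_above D" unfolding D_def by (auto intro!: bdd_aboveI)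
  obtain A0 where A0: "contractive n (vec A0)" "0 < \<bar>detf n A0\<bar>"
  proof -
    \<comment> \<open>After division by \<open>S\<close> the norms of the basis vectors sum to less
      than 1, so the triangle inequality gives contractivity.\<close>
    define S where "S = (\<Sum>i<n. norm (b i)) + 1"
    have S: "0 < S" by (simp add: S_def sum_nonneg add_nonneg_pos)
    define A0 where "A0 i j = (if i = j then 1 / S else 0)" for i j :: nat
    have vecA0: "vec A0 j = (1 / S) *\<^sub>R b j" if "j < n" for j
      using that by (simp add: vec_def A0_def if_distrib[of "\<lambda>a. a *\<^sub>R _"] cong: if_cong)
    have "contractive n (vec A0)"
      unfolding contractive_def
    proof
      fix a :: "nat \<Rightarrow> real"
      let ?\<rho> = "sqrt (\<Sum>i<n. (a i)\<^sup>2)"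
      have "norm (\<Sum>i<n. a i *\<^sub>R vec A0 i) \<le> (\<Sum>i<n. ?\<rho> * (norm (b i) / S))"
      proof (rule sum_norm_le)
        fix i assume i: "i \<in> {..<n}"
        have "\<bar>a i\<bar> = sqrt ((a i)\<^sup>2)" by simp
        also have "\<dots> \<le> ?\<rho>" using i by (intro real_sqrt_le_mono member_le_sum) auto
        finally have "\<bar>a i\<bar> * (norm (b i) / S) \<le> ?\<rho> * (norm (b i) / S)"
          using S by (intro mult_right_mono) auto
        then show "norm (a i *\<^sub>R vec A0 i) \<le> ?\<rho> * (norm (b i) / S)"
          using i S by (simp add: vecA0)
      qed
      also have "\<dots> = ?\<rho> * ((S - 1) / S)"
        by (simp add: sum_distrib_left[symmetric] sum_divide_distrib[symmetric] S_def)
      also have "\<dots> \<le> ?\<rho>" using S by (intro mult_left_le) (auto simp: sum_nonneg)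
      finally show "norm (\<Sum>i<n. a i *\<^sub>R vec A0 i) \<le> ?\<rho>" .
    qed
    moreover have "detf n A0 = (1 / S) ^ n"
      using detf_diagonal[of n "\<lambda>_. 1 / S"] unfolding A0_def by simp
    then have "0 < \<bar>detf n A0\<bar>" using S by simp
    ultimately show ?thesis by (rule that)
  qed
  then have "0 < Sup D"
    using bdd by (intro less_le_trans[OF A0(2) cSup_upper]) (auto simp: D_def)
  \<comment> \<open>\<open>5 / 8\<close> is the inverse of the gain \<open>8 / 5\<close> below: a
    determinant this close to the supremum cannot be increased by that factor.\<close>
  then have "5 / 8 * Sup D < Sup D" by simp
  moreover have "D \<noteq> {}" using A0(1) by (auto simp: D_def)
  ultimately obtain y where "y \<in> D" "5 / 8 * Sup D < y"
    using less_cSup_iff[OF _ bdd] by blast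
  then obtain A where A: "contractive n (vec A)" "5 / 8 * Sup D < \<bar>detf n A\<bar>"
    unfolding D_def by blast
  define comb where "comb v = (\<Sum>k<n. v k *\<^sub>R vec A k)" for v :: "nat \<Rightarrow> real"
  have "\<exists>q. orthonormal_cols n r q \<and> (\<forall>i<r. 1 / 4 \<le> norm (comb (\<lambda>k. q k i)))" if "r \<le> m" for r
    using that
  proof (induction r)
    case 0
    then show ?case by (auto simp: orthonormal_cols_def)
  next
    case (Suc r)
    then obtain q where q: "orthonormal_cols n r q" "\<forall>i<r. 1 / 4 \<le> norm (comb (\<lambda>k. q k i))" by auto
    show ?case
    proof (cases "\<exists>v. (\<Sum>k<n. v k * v k) = 1 \<and> (\<forall>j<r. (\<Sum>k<n. v k * q k j) = 0) \<and> 1 / 4 \<le> norm (comb v)")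
      case True
      then obtain v where v: "(\<Sum>k<n. v k * v k) = 1" "\<And>j. j < r \<Longrightarrow> (\<Sum>k<n. v k * q k j) = 0"
        "1 / 4 \<le> norm (comb v)" by blast
      from orthonormal_cols_Suc[OF q(1) v(1,2)] q(2) v(3) show ?thesis
        by (intro exI[of _ "\<lambda>k i. if i = r then v k else q k i"]) (auto simp: less_Suc_eq)
    next
      case False
      \<comment> \<open>Now every unit vector orthogonal to the chosen columns is mapped to norm
        below \<open>1 / 4\<close>. Once the columns are completed to a basis, this is the smallness
        that doubling requires on the last \<open>n - r\<close> directions.\<close>
      have "r \<le> n" using Suc.prems by (simp add: n_def)
      from orthonormal_cols_extend[OF q(1) this] obtain q'
        where q': "orthonormal_cols n n q'" "\<And>k i. i < r \<Longrightarrow> q' k i = q k i" by blast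
      define x' where "x' i = comb (\<lambda>k. q' k i)" for i
      define d :: "nat \<Rightarrow> real" where "d j = sqrt (4 / 5) * (if j < r then 1 else 2)" for j
      \<comment> \<open>As a matrix, \<open>A'\<close> is \<open>A\<close> times the orthogonal
        \<open>q'\<close> times the diagonal of \<open>d\<close>, so its determinant is
        explicit.\<close>
      define A' where "A' i j = (\<Sum>k<n. A i k * q' k j) * d j" for i j
      have cx': "contractive n x'"
        using contractive_orthonormal_cols[OF A(1) q'(1)] by (simp add: x'_def[abs_def] comb_def)
      have "contractive n (\<lambda>i. d i *\<^sub>R x' i)"
        unfolding d_def
      proof (rule contractive_double[OF cx' \<open>r \<le> n\<close>])
        fix a :: "nat \<Rightarrow> real"
        \<comment> \<open>Padding \<open>a\<close> by zeros makes the tail combination the image of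
          a vector \<open>w\<close> orthogonal to the first \<open>r\<close> columns; scaling by its
          length \<open>\<rho>\<close> reduces the bound to unit vectors.\<close>
        define a' where "a' i = (if r \<le> i then a i else 0)" for i
        define w where "w k = (\<Sum>i<n. q' k i * a' i)" for k
        define \<rho> where "\<rho> = sqrt (\<Sum>i\<in>{r..<n}. (a i)\<^sup>2)"
        have to_a': "(\<Sum>i\<in>{r..<n}. g (a i) i) = (\<Sum>i<n. g (a' i) i)"
          if "\<And>i. g 0 i = 0" for g :: "real \<Rightarrow> nat \<Rightarrow> 'b::comm_monoid_add"
          using that by (intro sum.mono_neutral_cong_left) (auto simp: a'_def)
        have ww: "(\<Sum>k<n. w k * w k) = \<rho>\<^sup>2"
          using orthonormal_cols_norm[OF q'(1), of a'] to_a'[of "\<lambda>a i. a\<^sup>2"]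
          by (simp add: \<rho>_def w_def power2_eq_square sum_nonneg)
        have wq: "(\<Sum>k<n. w k * q k j) = 0" if "j < r" for j
        proof -
          have "(\<Sum>k<n. w k * q k j) = (\<Sum>k<n. \<Sum>i<n. a' i * (q' k i * q' k j))"
            unfolding w_def using q'(2)[OF that] by (simp add: sum_distrib_left sum_distrib_right mult_ac)
          also have "\<dots> = (\<Sum>i<n. \<Sum>k<n. a' i * (q' k i * q' k j))" by (rule sum.swap)
          also have "\<dots> = (\<Sum>i<n. a' i * (\<Sum>k<n. q' k i * q' k j))" by (simp add: sum_distrib_left)
          also have "\<dots> = (\<Sum>i<n. 0)"
            using q'(1) that \<open>r \<le> n\<close> by (intro sum.cong) (auto simp: orthonormal_cols_def a'_def)
          finally show ?thesis by simp
        qed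
        have "(\<Sum>i\<in>{r..<n}. a i *\<^sub>R x' i) = (\<Sum>i<n. \<Sum>k<n. (q' k i * a' i) *\<^sub>R vec A k)"
          using to_a'[of "\<lambda>a i. a *\<^sub>R x' i"] by (simp add: x'_def comb_def scaleR_sum_right mult_ac)
        also have "\<dots> = (\<Sum>k<n. \<Sum>i<n. (q' k i * a' i) *\<^sub>R vec A k)" by (rule sum.swap)
        also have "\<dots> = comb w" by (simp add: comb_def w_def scaleR_sum_left)
        finally have eq: "(\<Sum>i\<in>{r..<n}. a i *\<^sub>R x' i) = comb w" .
        have "norm (comb w) \<le> (1 / 4) * \<rho>"
        proof (cases "\<rho> = 0")
          case True
          then have "w k = 0" if "k < n" for k
            using ww that by (simp add: sum_nonneg_eq_0_iff)
          then show ?thesis by (simp add: comb_def True)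
        next
          case False
          then have \<rho>: "0 < \<rho>" by (simp add: \<rho>_def sum_nonneg less_le)
          have "(\<Sum>k<n. (w k / \<rho>) * (w k / \<rho>)) = 1"
            using ww \<rho> by (simp add: sum_divide_distrib[symmetric] power2_eq_square)
          moreover have "(\<Sum>k<n. (w k / \<rho>) * q k j) = 0" if "j < r" for j
            using wq[OF that] by (simp add: sum_divide_distrib[symmetric])
          ultimately have "norm (comb (\<lambda>k. w k / \<rho>)) < 1 / 4"
            using \<open>\<not> (\<exists>v. (\<Sum>k<n. v k * v k) = 1 \<and> (\<forall>j<r. (\<Sum>k<n. v k * q k j) = 0) \<and> 1 / 4 \<le> norm (comb v))\<close>
            by (meson not_le)
          moreover have "comb w = \<rho> *\<^sub>R comb (\<lambda>k. w k / \<rho>)"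
            using \<rho> by (simp add: comb_def scaleR_sum_right)
          ultimately show ?thesis using \<rho> by simp
        qed
        then show "norm (\<Sum>i\<in>{r..<n}. a i *\<^sub>R x' i) \<le> 1 / 4 * sqrt (\<Sum>i\<in>{r..<n}. (a i)\<^sup>2)"
          unfolding eq \<rho>_def .
      qed
      also have "(\<lambda>i. d i *\<^sub>R x' i) = vec A'"
      proof
        fix j
        have "x' j = (\<Sum>k<n. \<Sum>i<n. (A i k * q' k j) *\<^sub>R b i)"
          by (simp add: x'_def comb_def vec_def scaleR_sum_right mult_ac)
        also have "\<dots> = (\<Sum>i<n. \<Sum>k<n. (A i k * q' k j) *\<^sub>R b i)" by (rule sum.swap)
        finally show "d j *\<^sub>R x' j = vec A' j"
          by (simp add: vec_def A'_def scaleR_sum_left scaleR_sum_right sum_distrib_right sum_distrib_left mult_ac)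
      qed
      finally have "\<bar>detf n A'\<bar> \<le> Sup D"
        using bdd by (intro cSup_upper) (auto simp: D_def)
      moreover have "8 / 5 * \<bar>detf n A\<bar> \<le> \<bar>detf n A'\<bar>"
      proof -
        have "\<bar>detf n q'\<bar> = 1"
          using q'(1) by (intro detf_orthogonal) (auto simp: orthonormal_cols_def)
        then have "\<bar>detf n A'\<bar> = \<bar>detf n A\<bar> * \<bar>\<Prod>j<n. d j\<bar>"
          unfolding A'_def[abs_def] detf_scale_columns detf_mult by (simp add: abs_mult)
        moreover have "8 / 5 \<le> \<bar>\<Prod>j<n. d j\<bar>"
        proof -
          have "(8 / 5 :: real) \<le> (8 / 5) ^ m"
            using False \<open>m \<noteq> 0\<close> by (intro self_le_power) auto
          also have "\<dots> = sqrt (4 / 5) ^ n * 2 ^ m"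
            by (simp add: n_def power_mult power_mult_distrib[symmetric])
          also have "\<dots> \<le> sqrt (4 / 5) ^ n * 2 ^ (n - r)"
            using Suc.prems by (intro mult_left_mono power_increasing) (auto simp: n_def)
          also have "2 ^ (n - r) = (\<Prod>j<n. if j < r then 1 else 2 :: real)"
          proof -
            have "{..<n} \<inter> - {j. j < r} = {r..<n}" by auto
            then show ?thesis by (simp add: prod.If_cases)
          qed
          also have "sqrt (4 / 5) ^ n * \<dots> = (\<Prod>j<n. d j)"
            unfolding d_def prod.distrib by simp
          finally show ?thesis by linarith
        qed
        ultimately show ?thesis
          using mult_left_mono[of "8 / 5" "\<bar>\<Prod>j<n. d j\<bar>" "\<bar>detf n A\<bar>"] by (simp add: mult.commute)
      qed
      ultimately show ?thesis using A(2) by linarith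
    qed
  qed
  from this[of m] obtain q where q: "orthonormal_cols n m q" "\<forall>i<m. 1 / 4 \<le> norm (comb (\<lambda>k. q k i))"
    by auto
  show ?thesis
  proof (rule that)
    show "contractive m (\<lambda>i. comb (\<lambda>k. q k i))"
      unfolding comb_def by (rule contractive_orthonormal_cols[OF A(1) q(1)])
  qed (use q(2) in auto)
qed

section \<open>Gaussian sequences\<close>

text \<open>The index type is left open: naturals index coefficients, pairs with \<open>bool\<close>
  two independent copies, and pairs of naturals a random matrix.\<close>

definition gauss :: "('i \<Rightarrow> real) measure" where
  "gauss = PiM UNIV (\<lambda>_. std_normal_distribution)"

lemma prob_space_gauss: "prob_space gauss"
  unfolding gauss_def by (intro prob_space_PiM prob_space_normal_density) simp

text \<open>For a countable index type the product sigma-algebra is the Borel sigma-algebra of the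
  function space, so continuous functions of the coordinates are measurable.\<close>

lemma sets_gauss [measurable_cong]: "sets (gauss :: ('i::countable \<Rightarrow> real) measure) = sets borel"
proof -
  have "sets (gauss :: ('i \<Rightarrow> real) measure) = sets (PiM UNIV (\<lambda>_. borel))"
    unfolding gauss_def by (intro sets_PiM_cong) auto
  then show ?thesis
    by (simp add: sets_PiM_equal_borel)
qed

lemma space_gauss [simp]: "space gauss = UNIV"
  by (simp add: gauss_def space_PiM)

lemma distr_gauss_component: "distr gauss std_normal_distribution (\<lambda>\<omega>. \<omega> i) = std_normal_distribution"
  unfolding gauss_def by (rule distr_PiM_component) (auto intro: prob_space_normal_density)

lemma indep_vars_gauss_coord:
  "prob_space.indep_vars (gauss :: ('i::countable \<Rightarrow> real) measure) (\<lambda>_. std_normal_distribution) (\<lambda>i \<omega>. \<omega> i) UNIV"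
proof -
  interpret prob_space "gauss :: ('i \<Rightarrow> real) measure" by (rule prob_space_gauss)
  have "distr gauss (PiM UNIV (\<lambda>_. std_normal_distribution)) (\<lambda>x. \<lambda>i\<in>UNIV. x i) = (gauss :: ('i \<Rightarrow> real) measure)"
    by (simp add: gauss_def distr_id2 restrict_UNIV)
  then show ?thesis
    by (subst indep_vars_iff_distr_eq_PiM) (auto simp: distr_gauss_component[unfolded gauss_def] gauss_def)
qed

lemma distributed_gauss_coord:
  "distributed gauss lborel (\<lambda>\<omega>. \<omega> (i :: 'i::countable)) std_normal_density"
  unfolding distributed_def
proof (intro conjI)
  have "distr gauss lborel (\<lambda>\<omega>. \<omega> i) = distr gauss std_normal_distribution (\<lambda>\<omega>. \<omega> i)"
    by (intro distr_cong) auto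
  then show "distr gauss lborel (\<lambda>\<omega>. \<omega> i) = density lborel std_normal_density"
    by (simp add: distr_gauss_component)
qed measurable

text \<open>Each block sum is standard normal because its squared weights add up to 1, and sums over
  disjoint blocks are independent. This one invariance covers relabelling, sign changes, splitting a
  Gaussian into pieces, and applying a Gaussian matrix to a unit vector.\<close>

proposition distr_gauss_block:
  fixes J :: "'i::countable \<Rightarrow> 'j::countable set" and c :: "'j \<Rightarrow> real"
  assumes disj: "disjoint_family J"
    and fin: "\<And>i. finite (J i)"
    and one: "\<And>i. (\<Sum>j\<in>J i. (c j)\<^sup>2) = 1"
  shows "distr gauss gauss (\<lambda>\<omega> i. \<Sum>j\<in>J i. c j * \<omega> j) = gauss"
proof -
  interpret prob_space "gauss :: ('j \<Rightarrow> real) measure" by (rule prob_space_gauss)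
  define X where "X i \<omega> = (\<Sum>j\<in>J i. c j * \<omega> j)" for i and \<omega> :: "'j \<Rightarrow> real"
  have rv [measurable]: "random_variable std_normal_distribution (X i)" for i
    unfolding X_def by measurable
  have "distr gauss std_normal_distribution (X i) = std_normal_distribution" for i
  proof -
    \<comment> \<open>Zero weights are dropped, since a normal density has positive
      deviation.\<close>
    define J' where "J' = {j\<in>J i. c j \<noteq> 0}"
    have J': "finite J'" "J' \<subseteq> J i" using fin by (auto simp: J'_def)
    have s1: "(\<Sum>j\<in>J'. (c j)\<^sup>2) = 1"
      unfolding one[of i, symmetric] by (intro sum.mono_neutral_left) (auto simp: J'_def fin)
    then have "J' \<noteq> {}" by auto
    have X: "X i = (\<lambda>\<omega>. \<Sum>j\<in>J'. c j * \<omega> j)"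
      unfolding X_def by (intro ext sum.mono_neutral_right) (auto simp: J'_def fin)
    have D: "distributed gauss lborel (\<lambda>\<omega>. c j * \<omega> j) (normal_density 0 \<bar>c j\<bar>)" if "j \<in> J'" for j
      using normal_density_affine[OF distributed_gauss_coord[of j], of "c j" 0] that
      by (simp add: J'_def)
    have "indep_vars (\<lambda>_. borel) (\<lambda>j \<omega>. c j * \<omega> j) J'"
      using indep_vars_compose2[OF indep_vars_subset[OF indep_vars_gauss_coord, of J'],
          of "\<lambda>j x. c j * x" "\<lambda>_. borel"] by simp
    from sum_indep_normal[OF J'(1) \<open>J' \<noteq> {}\<close> this, of "\<lambda>j. \<bar>c j\<bar>" "\<lambda>_. 0"] D
    have "distributed gauss lborel (X i) std_normal_density"
      by (auto simp: J'_def[symmetric] s1 X) (auto simp: J'_def)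
    then have "distr gauss lborel (X i) = std_normal_distribution"
      by (simp add: distributed_def)
    moreover have "distr gauss lborel (X i) = distr gauss std_normal_distribution (X i)"
      by (intro distr_cong) auto
    ultimately show ?thesis by simp
  qed
  note dX = this
  have "indep_vars (\<lambda>_. std_normal_distribution) X UNIV"
  proof -
    have "indep_vars (\<lambda>i. PiM (J i) (\<lambda>_. std_normal_distribution)) (\<lambda>i \<omega>. restrict (\<lambda>j. \<omega> j) (J i)) UNIV"
      by (rule indep_vars_restrict[OF indep_vars_gauss_coord _ disj]) auto
    from indep_vars_compose2[OF this, of "\<lambda>i x. \<Sum>j\<in>J i. c j * x j" "\<lambda>_. std_normal_distribution"]
    show ?thesis unfolding X_def by simp
  qed
  then have "distr gauss (PiM UNIV (\<lambda>_. std_normal_distribution)) (\<lambda>\<omega>. \<lambda>i\<in>UNIV. X i \<omega>)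
      = PiM UNIV (\<lambda>i. distr gauss std_normal_distribution (X i))"
    by (subst (asm) indep_vars_iff_distr_eq_PiM) (use rv in auto)
  then show ?thesis
    by (simp add: dX gauss_def[symmetric] restrict_UNIV) (simp add: X_def)
qed

lemma integrable_gauss_coord_power:
  "integrable gauss (\<lambda>\<omega>. (\<omega> (i :: 'i::countable)) ^ n)"
proof -
  have "integrable lborel (\<lambda>x. std_normal_density x *\<^sub>R x ^ n)"
    using integrable_std_normal_moment[of n] by simp
  then have "integrable std_normal_distribution (\<lambda>x. x ^ n)"
    by (subst integrable_density) auto
  then have "integrable (distr gauss std_normal_distribution (\<lambda>\<omega>. \<omega> i)) (\<lambda>x. x ^ n)"
    by (simp add: distr_gauss_component)
  then show ?thesis
    by (subst (asm) integrable_distr_eq) auto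
qed

lemma expectation_gauss_coord_square:
  "(\<integral>\<omega>. (\<omega> (i :: 'i::countable))\<^sup>2 \<partial>gauss) = 1"
proof -
  interpret prob_space "gauss :: ('i \<Rightarrow> real) measure" by (rule prob_space_gauss)
  show ?thesis
    using standard_normal_distributed_variance[OF distributed_gauss_coord[of i]]
      standard_normal_distributed_expectation[OF distributed_gauss_coord[of i]] by simp
qed

lemma integral_gauss_block:
  fixes J :: "'i::countable \<Rightarrow> 'j::countable set" and c :: "'j \<Rightarrow> real"
    and f :: "('i \<Rightarrow> real) \<Rightarrow> 'b::{banach, second_countable_topology}"
  assumes "disjoint_family J" "\<And>i. finite (J i)" "\<And>i. (\<Sum>j\<in>J i. (c j)\<^sup>2) = 1"
    and [measurable]: "f \<in> borel_measurable borel"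
  shows "(\<integral>\<omega>. f (\<lambda>i. \<Sum>j\<in>J i. c j * \<omega> j) \<partial>gauss) = (\<integral>\<omega>. f \<omega> \<partial>gauss)"
    and "integrable gauss (\<lambda>\<omega>. f (\<lambda>i. \<Sum>j\<in>J i. c j * \<omega> j)) \<longleftrightarrow> integrable gauss f"
proof -
  have [measurable]: "(\<lambda>\<omega> i. \<Sum>j\<in>J i. c j * \<omega> j) \<in> measurable gauss gauss"
    by (subst measurable_cong_sets[OF refl sets_gauss], rule measurable_coordinatewise_then_product)
       measurable
  note D = distr_gauss_block[OF assms(1-3)]
  have "(\<integral>\<omega>. f \<omega> \<partial>gauss) = (\<integral>\<omega>. f \<omega> \<partial>distr gauss gauss (\<lambda>\<omega> i. \<Sum>j\<in>J i. c j * \<omega> j))"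
    by (simp add: D)
  also have "\<dots> = (\<integral>\<omega>. f (\<lambda>i. \<Sum>j\<in>J i. c j * \<omega> j) \<partial>gauss)"
    by (rule integral_distr) auto
  finally show "(\<integral>\<omega>. f (\<lambda>i. \<Sum>j\<in>J i. c j * \<omega> j) \<partial>gauss) = (\<integral>\<omega>. f \<omega> \<partial>gauss)" ..
  have "integrable gauss f \<longleftrightarrow> integrable (distr gauss gauss (\<lambda>\<omega> i. \<Sum>j\<in>J i. c j * \<omega> j)) f"
    by (simp add: D)
  also have "\<dots> \<longleftrightarrow> integrable gauss (\<lambda>\<omega>. f (\<lambda>i. \<Sum>j\<in>J i. c j * \<omega> j))"
    by (rule integrable_distr_eq) auto
  finally show "integrable gauss (\<lambda>\<omega>. f (\<lambda>i. \<Sum>j\<in>J i. c j * \<omega> j)) \<longleftrightarrow> integrable gauss f" ..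
qed

text \<open>Two independent copies of a Gaussian sequence are indexed by the pairs \<open>(i, b)\<close>;
  \<open>mix S\<close> takes its coordinates in \<open>S\<close> from the second copy.\<close>

definition mix :: "'i set \<Rightarrow> ('i \<times> bool \<Rightarrow> real) \<Rightarrow> 'i \<Rightarrow> real" where
  "mix S \<omega> = (\<lambda>i. \<omega> (i, i \<in> S))"

lemma borel_measurable_mix [measurable]:
  "mix S \<in> borel_measurable (borel :: ('i::countable \<times> bool \<Rightarrow> real) measure)"
  unfolding mix_def by (rule measurable_coordinatewise_then_product) measurable

lemma integral_mix:
  fixes f :: "('i::countable \<Rightarrow> real) \<Rightarrow> real"
  assumes [measurable]: "f \<in> borel_measurable borel"
  shows "(\<integral>\<omega>. f (mix S \<omega>) \<partial>gauss) = (\<integral>\<omega>. f \<omega> \<partial>gauss)"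
    and "integrable gauss (\<lambda>\<omega>. f (mix S \<omega>)) \<longleftrightarrow> integrable gauss f"
  using integral_gauss_block[of "\<lambda>i. {(i, i \<in> S)}" "\<lambda>_. 1" f]
  by (auto simp: disjoint_family_on_def mix_def)

text \<open>Exchanging the two copies on the coordinates in \<open>T\<close> preserves the joint
  law, and acts on the index sets as symmetric difference with \<open>T\<close>.\<close>

lemma integral_mix_swap:
  fixes h :: "('i::countable \<Rightarrow> real) \<Rightarrow> ('i \<Rightarrow> real) \<Rightarrow> real"
  assumes [measurable]: "(\<lambda>\<omega>. h (mix S \<omega>) (mix S' \<omega>)) \<in> borel_measurable borel"
  shows "(\<integral>\<omega>. h (mix (sym_diff S T) \<omega>) (mix (sym_diff S' T) \<omega>) \<partial>gauss)
    = (\<integral>\<omega>. h (mix S \<omega>) (mix S' \<omega>) \<partial>gauss)"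
proof -
  let ?J = "\<lambda>(i, b). {(i :: 'i, b \<noteq> (i \<in> T))}"
  have "disjoint_family ?J"
    by (auto simp: disjoint_family_on_def)
  moreover have "mix (sym_diff A T) \<omega> = mix A (\<lambda>j. \<Sum>j\<in>?J j. 1 * \<omega> j)" for A \<omega>
    by (auto simp: mix_def fun_eq_iff intro!: arg_cong[of _ _ \<omega>])
  ultimately show ?thesis
    using integral_gauss_block(1)[of ?J "\<lambda>_. 1" "\<lambda>\<omega>. h (mix S \<omega>) (mix S' \<omega>)"]
    by (auto split: prod.splits)
qed

section \<open>The Efron--Stein inequality\<close>

lemma integrable_mult_of_square_integrable:
  fixes f g :: "'a \<Rightarrow> real"
  assumes [measurable]: "f \<in> borel_measurable M" "g \<in> borel_measurable M"
    and "integrable M (\<lambda>x. (f x)\<^sup>2)" "integrable M (\<lambda>x. (g x)\<^sup>2)"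
  shows "integrable M (\<lambda>x. f x * g x)"
proof (rule Bochner_Integration.integrable_bound)
  show "integrable M (\<lambda>x. (f x)\<^sup>2 + (g x)\<^sup>2)" using assms by simp
  have "\<bar>a * b\<bar> \<le> a\<^sup>2 + b\<^sup>2" for a b :: real
    using sum_squares_bound[of "\<bar>a\<bar>" "\<bar>b\<bar>"] mult_nonneg_nonneg[of "\<bar>a\<bar>" "\<bar>b\<bar>"]
    unfolding abs_mult power2_abs by linarith
  then show "AE x in M. norm (f x * g x) \<le> norm ((f x)\<^sup>2 + (g x)\<^sup>2)" by auto
qed measurable

text \<open>Let \<open>G D\<close> be the correlation of \<open>f\<close> with itself after
  resampling the coordinates in \<open>D\<close>. The variance is \<open>G {} - G {..<p}\<close>,
  which telescopes; resampling one further coordinate \<open>e\<close> costs at most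
  \<open>G {} - G {e}\<close>, the second moment of the positive part of the change.\<close>

proposition Efron_Stein:
  fixes f :: "(nat \<Rightarrow> real) \<Rightarrow> real"
  assumes f [measurable]: "f \<in> borel_measurable borel"
    and sq: "integrable gauss (\<lambda>\<omega>. (f \<omega>)\<^sup>2)"
    and dep: "\<And>\<omega> \<omega>'. (\<And>i. i < p \<Longrightarrow> \<omega> i = \<omega>' i) \<Longrightarrow> f \<omega> = f \<omega>'"
  shows "(\<integral>\<omega>. (f \<omega>)\<^sup>2 \<partial>gauss) - (\<integral>\<omega>. f \<omega> \<partial>gauss)\<^sup>2
    \<le> (\<Sum>e<p. \<integral>\<omega>. (max 0 (f (mix {} \<omega>) - f (mix {e} \<omega>)))\<^sup>2 \<partial>gauss)"
    and "\<And>e. integrable gauss (\<lambda>\<omega>. (max 0 (f (mix {} \<omega>) - f (mix {e} \<omega>)))\<^sup>2)"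
proof -
  interpret prob_space "gauss :: (nat \<times> bool \<Rightarrow> real) measure" by (rule prob_space_gauss)
  define G where "G D = (\<integral>\<omega>. f (mix {} \<omega>) * f (mix D \<omega>) \<partial>gauss)" for D
  have sqS: "integrable gauss (\<lambda>\<omega>. (f (mix S \<omega>))\<^sup>2)" for S
    using integral_mix(2)[of "\<lambda>\<omega>. (f \<omega>)\<^sup>2" S] sq by simp
  have int: "integrable gauss (\<lambda>\<omega>. f (mix S \<omega>) * f (mix S' \<omega>))" for S S'
    by (rule integrable_mult_of_square_integrable) (auto intro: sqS)
  \<comment> \<open>Swapping the copies on \<open>S\<close> turns the first index set into the empty
    one.\<close>
  have gG: "(\<integral>\<omega>. f (mix S \<omega>) * f (mix S' \<omega>) \<partial>gauss) = G (sym_diff S S')" for S S'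
    using integral_mix_swap[of "\<lambda>a b. f a * f b" S S' S] by (simp add: G_def Un_commute)
  have int_diff: "integrable gauss (\<lambda>\<omega>. (f (mix S \<omega>) - f (mix S' \<omega>))\<^sup>2)" for S S'
    unfolding power2_diff using sqS int[of S S'] by (auto simp: mult.assoc)
  have diff: "(\<integral>\<omega>. (f (mix S \<omega>) - f (mix S' \<omega>))\<^sup>2 \<partial>gauss) = 2 * (G {} - G (sym_diff S S'))" for S S'
  proof -
    have "(\<integral>\<omega>. (f (mix S \<omega>) - f (mix S' \<omega>))\<^sup>2 \<partial>gauss) =
      (\<integral>\<omega>. f (mix S \<omega>) * f (mix S \<omega>) + f (mix S' \<omega>) * f (mix S' \<omega>) - 2 * (f (mix S \<omega>) * f (mix S' \<omega>)) \<partial>gauss)"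
      by (intro Bochner_Integration.integral_cong) (auto simp: power2_eq_square algebra_simps)
    also have "\<dots> = G {} + G {} - 2 * G (sym_diff S S')"
      using int gG[of S S] gG[of S' S'] gG[of S S'] by simp
    finally show ?thesis by simp
  qed
  show posint: "integrable gauss (\<lambda>\<omega>. (max 0 (f (mix {} \<omega>) - f (mix {e} \<omega>)))\<^sup>2)" for e
    by (rule Bochner_Integration.integrable_bound[OF int_diff[of "{}" "{e}"]]) (auto simp: max_def)
  \<comment> \<open>By exchanging the two copies of coordinate \<open>e\<close>, the positive and
    negative parts have equal second moments; each is half of that of the difference.\<close>
  have pos: "(\<integral>\<omega>. (max 0 (f (mix {} \<omega>) - f (mix {e} \<omega>)))\<^sup>2 \<partial>gauss) = G {} - G {e}" for e
  proof -
    have "integrable gauss (\<lambda>\<omega>. (max 0 (f (mix {e} \<omega>) - f (mix {} \<omega>)))\<^sup>2)"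
      by (rule Bochner_Integration.integrable_bound[OF int_diff[of "{}" "{e}"]])
        (auto simp: max_def power2_commute)
    then have "(\<integral>\<omega>. (max 0 (f (mix {} \<omega>) - f (mix {e} \<omega>)))\<^sup>2 \<partial>gauss)
        + (\<integral>\<omega>. (max 0 (f (mix {e} \<omega>) - f (mix {} \<omega>)))\<^sup>2 \<partial>gauss)
      = (\<integral>\<omega>. (max 0 (f (mix {} \<omega>) - f (mix {e} \<omega>)))\<^sup>2 + (max 0 (f (mix {e} \<omega>) - f (mix {} \<omega>)))\<^sup>2 \<partial>gauss)"
      using posint by simp
    also have "\<dots> = (\<integral>\<omega>. (f (mix {} \<omega>) - f (mix {e} \<omega>))\<^sup>2 \<partial>gauss)"
      by (intro Bochner_Integration.integral_cong) (auto simp: max_def power2_commute)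
    also have "\<dots> = 2 * (G {} - G {e})" by (simp add: diff)
    also have "(\<integral>\<omega>. (max 0 (f (mix {e} \<omega>) - f (mix {} \<omega>)))\<^sup>2 \<partial>gauss)
      = (\<integral>\<omega>. (max 0 (f (mix {} \<omega>) - f (mix {e} \<omega>)))\<^sup>2 \<partial>gauss)"
      using integral_mix_swap[of "\<lambda>a b. (max 0 (f a - f b))\<^sup>2" "{}" "{e}" "{e}"] by simp
    finally show ?thesis by simp
  qed
  have step: "G {..<e} - G {..<Suc e} \<le> G {} - G {e}" for e :: nat
  proof -
    have sd: "sym_diff {e} {..<e} = {..<Suc e}" "sym_diff {e} {..<Suc e} = {..<e}"
      "sym_diff {..<e} {..<Suc e} = {e}" by auto
    \<comment> \<open>The bound \<open>2 * a * b \<le> a\<^sup>2 + b\<^sup>2\<close> is applied to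
      the changes at coordinate \<open>e\<close> before and after resampling the coordinates below
      \<open>e\<close>. The four products contribute only \<open>G {..<e}\<close> and
      \<open>G {..<Suc e}\<close>, each twice.\<close>
    have "(\<integral>\<omega>. 2 * ((f (mix {} \<omega>) - f (mix {e} \<omega>)) * (f (mix {..<e} \<omega>) - f (mix {..<Suc e} \<omega>))) \<partial>gauss)
      = (\<integral>\<omega>. 2 * (f (mix {} \<omega>) * f (mix {..<e} \<omega>) - f (mix {} \<omega>) * f (mix {..<Suc e} \<omega>)
          - f (mix {e} \<omega>) * f (mix {..<e} \<omega>) + f (mix {e} \<omega>) * f (mix {..<Suc e} \<omega>)) \<partial>gauss)"
      by (intro Bochner_Integration.integral_cong) (auto simp: algebra_simps)
    also have "\<dots> = 4 * (G {..<e} - G {..<Suc e})"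
      using int gG[of "{e}" "{..<e}"] gG[of "{e}" "{..<Suc e}"] gG[of "{}" "{..<e}"] gG[of "{}" "{..<Suc e}"]
      unfolding sd by simp
    finally have "4 * (G {..<e} - G {..<Suc e}) =
      (\<integral>\<omega>. 2 * ((f (mix {} \<omega>) - f (mix {e} \<omega>)) * (f (mix {..<e} \<omega>) - f (mix {..<Suc e} \<omega>))) \<partial>gauss)"
      by simp
    also have "\<dots> \<le> (\<integral>\<omega>. (f (mix {} \<omega>) - f (mix {e} \<omega>))\<^sup>2 + (f (mix {..<e} \<omega>) - f (mix {..<Suc e} \<omega>))\<^sup>2 \<partial>gauss)"
    proof (intro integral_mono)
      show "integrable gauss (\<lambda>\<omega>. 2 * ((f (mix {} \<omega>) - f (mix {e} \<omega>)) * (f (mix {..<e} \<omega>) - f (mix {..<Suc e} \<omega>))))"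
        by (intro integrable_mult_right integrable_mult_of_square_integrable int_diff) auto
    qed (use int_diff sum_squares_bound in \<open>auto simp: mult.assoc\<close>)
    also have "\<dots> = 4 * (G {} - G {e})"
      using int_diff diff[of "{}" "{e}"] diff[of "{..<e}" "{..<Suc e}"] unfolding sd by simp
    finally show ?thesis by simp
  qed
  have "G {} - G {..<p} = (\<Sum>e<p. G {..<e} - G {..<Suc e})"
    by (subst sum_lessThan_telescope') simp
  also have "\<dots> \<le> (\<Sum>e<p. G {} - G {e})"
    by (intro sum_mono step)
  finally have tele: "G {} - G {..<p} \<le> (\<Sum>e<p. G {} - G {e})" .
  have "G {} = (\<integral>\<omega>. (f \<omega>)\<^sup>2 \<partial>gauss)"
    using integral_mix(1)[of "\<lambda>\<omega>. (f \<omega>)\<^sup>2" "{}"] by (simp add: G_def power2_eq_square)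
  moreover have "G {..<p} = (\<integral>\<omega>. f \<omega> \<partial>gauss)\<^sup>2"
  proof -
    \<comment> \<open>As \<open>f\<close> sees only coordinates below \<open>p\<close>, resampling
      these amounts to taking an independent copy, and the correlation factors.\<close>
    have "G {..<p} = (\<integral>\<omega>. f (mix {} \<omega>) * f (mix UNIV \<omega>) \<partial>gauss)"
      unfolding G_def by (intro Bochner_Integration.integral_cong refl arg_cong2[of _ _ _ _ "(*)"] dep)
        (auto simp: mix_def)
    also have "\<dots> = (\<integral>\<omega>. f (mix {} \<omega>) \<partial>gauss) * (\<integral>\<omega>. f (mix UNIV \<omega>) \<partial>gauss)"
    proof (rule indep_var_lebesgue_integral)
      let ?A = "\<lambda>b. UNIV \<times> {b} :: (nat \<times> bool) set"
      let ?h = "\<lambda>b x. f (\<lambda>i. x (i, b))"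
      have meas: "?h b \<in> borel_measurable (PiM (?A b) (\<lambda>_. std_normal_distribution))" for b
      proof -
        have "(\<lambda>x i. x (i, b)) \<in> borel_measurable (PiM (?A b) (\<lambda>_. std_normal_distribution))"
          by (rule measurable_coordinatewise_then_product)
            (rule measurable_compose[OF measurable_component_singleton], auto)
        then show ?thesis by measurable
      qed
      have "indep_var borel (?h False \<circ> (\<lambda>\<omega>. restrict (\<lambda>j. \<omega> j) (?A False)))
          borel (?h True \<circ> (\<lambda>\<omega>. restrict (\<lambda>j. \<omega> j) (?A True)))"
        by (rule indep_var_compose[OF indep_var_restrict[OF indep_vars_gauss_coord] meas meas]) auto
      then show "indep_var borel (\<lambda>\<omega>. f (mix {} \<omega>)) borel (\<lambda>\<omega>. f (mix UNIV \<omega>))"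
        by (simp add: comp_def mix_def)
      have "integrable gauss (\<lambda>\<omega>. f (mix S \<omega>))" for S
        using square_integrable_imp_integrable[OF _ sqS[of S]] by simp
      then show "integrable gauss (\<lambda>\<omega>. f (mix {} \<omega>))" "integrable gauss (\<lambda>\<omega>. f (mix UNIV \<omega>))"
        by blast+
    qed
    also have "\<dots> = (\<integral>\<omega>. f \<omega> \<partial>gauss)\<^sup>2"
      by (simp add: integral_mix power2_eq_square)
    finally show ?thesis .
  qed
  ultimately show "(\<integral>\<omega>. (f \<omega>)\<^sup>2 \<partial>gauss) - (\<integral>\<omega>. f \<omega> \<partial>gauss)\<^sup>2
    \<le> (\<Sum>e<p. \<integral>\<omega>. (max 0 (f (mix {} \<omega>) - f (mix {e} \<omega>)))\<^sup>2 \<partial>gauss)"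
    using tele by (simp add: pos)
qed

section \<open>Norms of Gaussian combinations\<close>

text \<open>Convexity of the norm along the directions weighted by their own decreases; this replaces a
  subgradient, and with it the Hahn--Banach theorem.\<close>

lemma sum_squares_decrease_le:
  fixes x :: "nat \<Rightarrow> 'a::real_normed_vector" and V :: 'a and r :: "nat \<Rightarrow> nat"
  assumes contr: "contractive m x"
    and r: "\<And>e. e < p \<Longrightarrow> r e < m"
    and Z: "\<And>i. i < m \<Longrightarrow> (\<Sum>e\<in>{e\<in>{..<p}. r e = i}. (t e)\<^sup>2) \<le> Z" and "0 \<le> Z"
  shows "(\<Sum>e<p. (max 0 (norm V - norm (V - t e *\<^sub>R x (r e))))\<^sup>2) \<le> Z"
proof -
  note lip = contractiveD[OF contr]
  define d where "d e = max 0 (norm V - norm (V - t e *\<^sub>R x (r e)))" for e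
  have d0: "0 \<le> d e" for e by (simp add: d_def)
  define W where "W = (\<Sum>e<p. (d e)\<^sup>2)"
  have W0: "0 \<le> W" by (simp add: W_def sum_nonneg)
  have "(\<Sum>e<p. d e) * norm V - norm (\<Sum>e<p. (d e * t e) *\<^sub>R x (r e))
    \<le> norm ((\<Sum>e<p. d e) *\<^sub>R V - (\<Sum>e<p. (d e * t e) *\<^sub>R x (r e)))"
    using norm_triangle_ineq2[of "(\<Sum>e<p. d e) *\<^sub>R V"] by (simp add: sum_nonneg d0)
  also have "(\<Sum>e<p. d e) *\<^sub>R V - (\<Sum>e<p. (d e * t e) *\<^sub>R x (r e))
    = (\<Sum>e<p. d e *\<^sub>R (V - t e *\<^sub>R x (r e)))"
    by (simp add: scaleR_sum_left sum_subtractf scaleR_diff_right)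
  \<comment> \<open>If \<open>d e\<close> is positive, moving along direction \<open>e\<close>
    lowers the norm of \<open>V\<close> by exactly \<open>d e\<close>; otherwise the term
    vanishes.\<close>
  also have "norm \<dots> \<le> (\<Sum>e<p. d e * (norm V - d e))"
  proof (rule sum_norm_le)
    fix e
    show "norm (d e *\<^sub>R (V - t e *\<^sub>R x (r e))) \<le> d e * (norm V - d e)"
      by (cases "d e = 0") (auto simp: d_def max_def abs_mult split: if_splits)
  qed
  also have "\<dots> = (\<Sum>e<p. d e) * norm V - W"
    by (simp add: W_def sum_distrib_right right_diff_distrib sum_subtractf power2_eq_square)
  finally have "W \<le> norm (\<Sum>e<p. (d e * t e) *\<^sub>R x (r e))" by simp
  \<comment> \<open>Directions sharing a vector \<open>x i\<close> are grouped, so that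
    contractivity applies and Cauchy--Schwarz can be used within each group.\<close>
  also have "(\<Sum>e<p. (d e * t e) *\<^sub>R x (r e)) = (\<Sum>i<m. (\<Sum>e\<in>{e\<in>{..<p}. r e = i}. d e * t e) *\<^sub>R x i)"
  proof -
    have "(\<Sum>e<p. (d e * t e) *\<^sub>R x (r e))
      = (\<Sum>i<m. \<Sum>e\<in>{e\<in>{..<p}. r e = i}. (d e * t e) *\<^sub>R x (r e))"
      by (rule sum.group[symmetric]) (auto simp: r)
    then show ?thesis by (simp add: scaleR_sum_left)
  qed
  also have "norm \<dots> \<le> sqrt (\<Sum>i<m. (\<Sum>e\<in>{e\<in>{..<p}. r e = i}. d e * t e)\<^sup>2)" by (rule lip)
  also have "\<dots> \<le> sqrt (\<Sum>i<m. (\<Sum>e\<in>{e\<in>{..<p}. r e = i}. (d e)\<^sup>2) * Z)"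
  proof (intro real_sqrt_le_mono sum_mono)
    fix i assume "i \<in> {..<m}"
    have "(\<Sum>e\<in>{e\<in>{..<p}. r e = i}. d e * t e)\<^sup>2
      \<le> (\<Sum>e\<in>{e\<in>{..<p}. r e = i}. (d e)\<^sup>2) * (\<Sum>e\<in>{e\<in>{..<p}. r e = i}. (t e)\<^sup>2)"
      by (rule Cauchy_Schwarz_ineq_sum)
    also have "\<dots> \<le> (\<Sum>e\<in>{e\<in>{..<p}. r e = i}. (d e)\<^sup>2) * Z"
      using Z \<open>i \<in> {..<m}\<close> by (intro mult_left_mono) (auto simp: sum_nonneg)
    finally show "(\<Sum>e\<in>{e\<in>{..<p}. r e = i}. d e * t e)\<^sup>2 \<le> \<dots>" .
  qed
  also have "(\<Sum>i<m. (\<Sum>e\<in>{e\<in>{..<p}. r e = i}. (d e)\<^sup>2) * Z) = W * Z"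
    unfolding W_def sum_distrib_right[symmetric]
    by (subst sum.group) (auto simp: r)
  \<comment> \<open>The chain bounds \<open>W\<close> by \<open>sqrt (W * Z)\<close>; squaring and
    cancelling \<open>W\<close> leaves the claim.\<close>
  finally have "W\<^sup>2 \<le> W * Z"
    using W0 real_le_rsqrt[of W "W * Z"] \<open>0 \<le> Z\<close>
    by (metis mult_nonneg_nonneg power_mono real_sqrt_pow2)
  then have "W \<le> Z"
    using W0 \<open>0 \<le> Z\<close> by (cases "W = 0") (auto simp: power2_eq_square)
  then show ?thesis by (simp add: W_def d_def)
qed

section \<open>Fluctuations of sums of squared Gaussians\<close>

text \<open>The variance of the square of a standard normal variable, whose mean is 1; the number of
  pieces below is chosen against it.\<close>

definition coord_square_variance :: real where
  "coord_square_variance = (\<integral>\<omega>. ((\<omega> ())\<^sup>2 - 1)\<^sup>2 \<partial>gauss)"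

lemma integrable_gauss_coord_square_dev:
  "integrable gauss (\<lambda>\<omega>. ((\<omega> (i :: 'i::countable))\<^sup>2 - 1)\<^sup>2)"
proof -
  interpret prob_space "gauss :: ('i \<Rightarrow> real) measure" by (rule prob_space_gauss)
  have "((\<omega> i)\<^sup>2 - 1)\<^sup>2 = \<omega> i ^ 4 + 1 - 2 * (\<omega> i)\<^sup>2" for \<omega> :: "'i \<Rightarrow> real"
    unfolding power2_diff by (simp add: power_mult[symmetric])
  moreover have "integrable gauss (\<lambda>\<omega>. \<omega> i ^ 4 + 1 - 2 * (\<omega> i)\<^sup>2)"
    using integrable_gauss_coord_power[of i 4] integrable_gauss_coord_power[of i 2]
    by (intro Bochner_Integration.integrable_diff Bochner_Integration.integrable_add
        integrable_mult_right integrable_const) auto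
  ultimately show ?thesis by simp
qed

lemma expectation_gauss_coord_square_dev:
  "(\<integral>\<omega>. ((\<omega> (i :: 'i::countable))\<^sup>2 - 1)\<^sup>2 \<partial>gauss) = coord_square_variance"
  using integral_gauss_block(1)[of "\<lambda>_ :: unit. {i}" "\<lambda>_. 1" "\<lambda>\<omega>. ((\<omega> ())\<^sup>2 - 1)\<^sup>2"]
  by (simp add: disjoint_family_on_def coord_square_variance_def)

text \<open>Independence and mean zero remove the mixed terms, so the second moment grows linearly
  in the number of coordinates: the weak law of large numbers in quantitative form.\<close>

lemma sum_gauss_coord_square_dev:
  fixes A :: "'i::countable set"
  assumes "finite A"
  shows "(\<integral>\<omega>. (\<Sum>j\<in>A. (\<omega> j)\<^sup>2 - 1)\<^sup>2 \<partial>gauss) = card A * coord_square_variance"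
    and "integrable gauss (\<lambda>\<omega>. (\<Sum>j\<in>A. (\<omega> j)\<^sup>2 - 1)\<^sup>2)"
proof -
  interpret prob_space "gauss :: ('i \<Rightarrow> real) measure" by (rule prob_space_gauss)
  let ?q = "\<lambda>j \<omega> :: 'i \<Rightarrow> real. (\<omega> j)\<^sup>2 - 1"
  have int1: "integrable gauss (?q j)" for j
    using integrable_gauss_coord_power[of j 2] by simp
  have int2: "integrable gauss (\<lambda>\<omega>. ?q j \<omega> * ?q j' \<omega>)" for j j'
    by (rule integrable_mult_of_square_integrable) (auto intro: integrable_gauss_coord_square_dev)
  have E: "(\<integral>\<omega>. ?q j \<omega> * ?q j' \<omega> \<partial>gauss) = (if j = j' then coord_square_variance else 0)" for j j'
  proof (cases "j = j'")
    case True
    then show ?thesis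
      using expectation_gauss_coord_square_dev[of j] by (simp add: power2_eq_square)
  next
    case False
    have "indep_var borel ((\<lambda>x. (x j)\<^sup>2 - 1) \<circ> (\<lambda>\<omega>. restrict (\<lambda>j. \<omega> j) {j}))
        borel ((\<lambda>x. (x j')\<^sup>2 - 1) \<circ> (\<lambda>\<omega>. restrict (\<lambda>j. \<omega> j) {j'}))"
      using False by (intro indep_var_compose[OF indep_var_restrict[OF indep_vars_gauss_coord]]) auto
    then have "indep_var borel (?q j) borel (?q j')"
      by (simp add: comp_def)
    then have "(\<integral>\<omega>. ?q j \<omega> * ?q j' \<omega> \<partial>gauss) = (\<integral>\<omega>. ?q j \<omega> \<partial>gauss) * (\<integral>\<omega>. ?q j' \<omega> \<partial>gauss)"
      by (intro indep_var_lebesgue_integral int1)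
    also have "(\<integral>\<omega>. ?q j \<omega> \<partial>gauss) = 0"
      using integrable_gauss_coord_power[of j 2] by (simp add: expectation_gauss_coord_square prob_space[simplified])
    finally show ?thesis using False by simp
  qed
  have sq: "(\<Sum>j\<in>A. ?q j \<omega>)\<^sup>2 = (\<Sum>j\<in>A. \<Sum>j'\<in>A. ?q j \<omega> * ?q j' \<omega>)" for \<omega>
    by (simp add: power2_eq_square sum_product)
  show "(\<integral>\<omega>. (\<Sum>j\<in>A. ?q j \<omega>)\<^sup>2 \<partial>gauss) = card A * coord_square_variance"
    unfolding sq using assms int2 by (simp add: E)
  show "integrable gauss (\<lambda>\<omega>. (\<Sum>j\<in>A. (\<omega> j)\<^sup>2 - 1)\<^sup>2)"
    unfolding sq using int2 by simp
qed

section \<open>Variance of the norm of a Gaussian combination\<close>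

lemma continuous_on_comb:
  fixes x :: "nat \<Rightarrow> 'a::real_normed_vector" and u :: 'a
  shows "continuous_on UNIV (\<lambda>s :: nat \<Rightarrow> real. norm (u + (\<Sum>i<m. s i *\<^sub>R x i)))"
  by (intro continuous_intros continuous_on_product_coordinates)

lemma borel_measurable_comb [measurable]:
  fixes x :: "nat \<Rightarrow> 'a::real_normed_vector" and u :: 'a
  shows "(\<lambda>s :: nat \<Rightarrow> real. norm (u + (\<Sum>i<m. s i *\<^sub>R x i))) \<in> borel_measurable borel"
  by (intro borel_measurable_continuous_onI continuous_on_comb)

lemma integrable_norm_gauss_comb:
  fixes x :: "nat \<Rightarrow> 'a::real_normed_vector" and u :: 'a
  assumes contr: "contractive m x"
  shows "integrable gauss (\<lambda>s. (norm (u + (\<Sum>i<m. s i *\<^sub>R x i)))\<^sup>2)"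
    and "integrable gauss (\<lambda>s. norm (u + (\<Sum>i<m. s i *\<^sub>R x i)))"
proof -
  note lip = contractiveD[OF contr]
  interpret prob_space "gauss :: (nat \<Rightarrow> real) measure" by (rule prob_space_gauss)
  show 1: "integrable gauss (\<lambda>s. (norm (u + (\<Sum>i<m. s i *\<^sub>R x i)))\<^sup>2)"
  proof (rule Bochner_Integration.integrable_bound)
    show "integrable gauss (\<lambda>s. 2 * (norm u)\<^sup>2 + 2 * (\<Sum>i<m. (s i)\<^sup>2))"
      by (intro Bochner_Integration.integrable_add integrable_mult_right integrable_const
          Bochner_Integration.integrable_sum integrable_gauss_coord_power)
    have "(norm (u + (\<Sum>i<m. s i *\<^sub>R x i)))\<^sup>2 \<le> 2 * (norm u)\<^sup>2 + 2 * (\<Sum>i<m. (s i)\<^sup>2)" for s :: "nat \<Rightarrow> real"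
    proof -
      let ?r = "sqrt (\<Sum>i<m. (s i)\<^sup>2)"
      have "norm (u + (\<Sum>i<m. s i *\<^sub>R x i)) \<le> norm u + ?r"
        using norm_triangle_ineq[of u "\<Sum>i<m. s i *\<^sub>R x i"] lip[of s] by linarith
      then have "(norm (u + (\<Sum>i<m. s i *\<^sub>R x i)))\<^sup>2 \<le> (norm u + ?r)\<^sup>2"
        by (intro power_mono) auto
      also have "\<dots> \<le> 2 * (norm u)\<^sup>2 + 2 * ?r\<^sup>2"
        using sum_squares_bound[of "norm u" ?r] by (simp only: power2_sum)
      finally show ?thesis by (simp add: sum_nonneg)
    qed
    then show "AE s in gauss. norm ((norm (u + (\<Sum>i<m. s i *\<^sub>R x i)))\<^sup>2)
        \<le> norm (2 * (norm u)\<^sup>2 + 2 * (\<Sum>i<m. (s i :: real)\<^sup>2))"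
      by (intro AE_I2) (simp add: sum_nonneg abs_of_nonneg)
  qed measurable
  show "integrable gauss (\<lambda>s. norm (u + (\<Sum>i<m. s i *\<^sub>R x i)))"
    by (rule square_integrable_imp_integrable[OF _ 1]) measurable
qed

text \<open>Splitting each Gaussian into many small independent pieces makes the Efron--Stein bound
  independent of the dimension, up to a law-of-large-numbers error.\<close>

proposition variance_norm_gauss_comb:
  fixes x :: "nat \<Rightarrow> 'a::real_normed_vector" and u :: 'a
  assumes contr: "contractive m x"
  defines "F \<equiv> \<lambda>s :: nat \<Rightarrow> real. norm (u + (\<Sum>i<m. s i *\<^sub>R x i))"
  shows "(\<integral>s. (F s)\<^sup>2 \<partial>gauss) - (\<integral>s. F s \<partial>gauss)\<^sup>2 \<le> 6"
proof -
  interpret prob_space "gauss :: (nat \<times> bool \<Rightarrow> real) measure" by (rule prob_space_gauss)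
  \<comment> \<open>This makes the expected error \<open>m * (2 * coord_square_variance / k)\<close>
    at most 1, which turns the bound 5 into 6.\<close>
  obtain n where n: "2 * real m * coord_square_variance < real n"
    using reals_Archimedean2 by blast
  define k where "k = Suc n"
  have k: "2 * real m * coord_square_variance < real k" "0 < k"
    using n by (auto simp: k_def)
  define B where "B i = {i * k..<i * k + k}" for i
  \<comment> \<open>Coordinate \<open>i\<close> is a sum of the \<open>k\<close> pieces in
    \<open>B i\<close>, each of variance \<open>1 / k\<close>; the result is again a standard
    Gaussian sequence.\<close>
  define \<Phi> where "\<Phi> \<omega> = (\<lambda>i. \<Sum>e\<in>B i. (1 / sqrt k) * \<omega> e)" for \<omega> :: "nat \<Rightarrow> real"
  define f where "f \<omega> = F (\<Phi> \<omega>)" for \<omega>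
  have eB: "e \<in> B i \<longleftrightarrow> e div k = i" for e i
  proof
    show "e \<in> B i \<Longrightarrow> e div k = i"
      by (intro div_nat_eqI) (auto simp: B_def algebra_simps)
    show "e div k = i \<Longrightarrow> e \<in> B i"
      using div_mult_mod_eq[of e k] mod_less_divisor[OF k(2), of e] by (auto simp: B_def)
  qed
  have ltmk: "e < m * k \<longleftrightarrow> e div k < m" for e
    using k(2) by (simp add: div_less_iff_less_mult)
  have disj: "disjoint_family B" by (auto simp: disjoint_family_on_def eB)
  have finB [simp]: "finite (B i)" and cardB: "card (B i) = k" for i by (auto simp: B_def)
  have one: "(\<Sum>e\<in>B i. (1 / sqrt k)\<^sup>2) = 1" for i
    using k(2) by (simp add: cardB power_divide)
  have F [measurable]: "F \<in> borel_measurable borel"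
    unfolding F_def by measurable
  have \<Phi> [measurable]: "\<Phi> \<in> borel_measurable borel"
    unfolding \<Phi>_def by (rule measurable_coordinatewise_then_product) measurable
  have f [measurable]: "f \<in> borel_measurable borel"
    unfolding f_def by measurable
  have law: "(\<integral>\<omega>. h (\<Phi> \<omega>) \<partial>gauss) = (\<integral>s. h s \<partial>gauss)"
    "integrable gauss (\<lambda>\<omega>. h (\<Phi> \<omega>)) = integrable gauss h"
    if "h \<in> borel_measurable borel" for h :: "(nat \<Rightarrow> real) \<Rightarrow> real"
    unfolding \<Phi>_def using integral_gauss_block[OF disj finB one that] by auto
  have sqf: "integrable gauss (\<lambda>\<omega>. (f \<omega>)\<^sup>2)"
    unfolding f_def using law(2)[of "\<lambda>s. (F s)\<^sup>2"] integrable_norm_gauss_comb(1)[OF contr]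
    by (simp add: F_def)
  have dep: "f \<omega> = f \<omega>'" if eq: "\<And>i. i < m * k \<Longrightarrow> \<omega> i = \<omega>' i" for \<omega> \<omega>'
  proof -
    have "\<Phi> \<omega> i = \<Phi> \<omega>' i" if "i < m" for i
      unfolding \<Phi>_def using \<open>i < m\<close> by (intro sum.cong refl arg_cong2[of _ _ _ _ "(*)"] eq) (auto simp: eB ltmk)
    then show ?thesis by (simp add: f_def F_def)
  qed
  \<comment> \<open>\<open>Y i\<close> is the deviation from the mean \<open>2 * k\<close> of the
    squared pieces of block \<open>i\<close> in both copies. In \<open>Z\<close>, the sum of the
    squares replaces the largest deviation, via
    \<open>4 + 2 * y \<le> 5 + y\<^sup>2\<close>.\<close>
  define Y where "Y i \<omega> = (\<Sum>j\<in>B i \<times> UNIV. (\<omega> j)\<^sup>2 - 1)" for i and \<omega> :: "nat \<times> bool \<Rightarrow> real"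
  define Z where "Z \<omega> = 5 + (\<Sum>i<m. (Y i \<omega> / k)\<^sup>2)" for \<omega>
  have cardBU: "card (B i \<times> (UNIV :: bool set)) = 2 * k" for i
    by (simp add: card_cartesian_product cardB)
  have pointwise: "(\<Sum>e<m * k. (max 0 (f (mix {} \<omega>) - f (mix {e} \<omega>)))\<^sup>2) \<le> Z \<omega>" for \<omega>
  proof -
    define V where "V = u + (\<Sum>i<m. \<Phi> (mix {} \<omega>) i *\<^sub>R x i)"
    define t where "t e = (\<omega> (e, False) - \<omega> (e, True)) / sqrt k" for e
    have f0: "f (mix {} \<omega>) = norm V" by (simp add: f_def F_def V_def)
    \<comment> \<open>Resampling piece \<open>e\<close> changes only coordinate
      \<open>e div k\<close>, and lowers it by \<open>t e\<close>.\<close>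
    have fe: "f (mix {e} \<omega>) = norm (V - t e *\<^sub>R x (e div k))" if "e < m * k" for e
    proof -
      have diff: "\<Phi> (mix {e} \<omega>) i = \<Phi> (mix {} \<omega>) i - (if i = e div k then t e else 0)" for i
      proof -
        have "\<Phi> (mix {e} \<omega>) i = (\<Sum>e'\<in>B i. (1 / sqrt k) * mix {} \<omega> e' - (if e' = e then t e else 0))"
          unfolding \<Phi>_def by (intro sum.cong) (auto simp: mix_def t_def diff_divide_distrib)
        also have "\<dots> = \<Phi> (mix {} \<omega>) i - (if e \<in> B i then t e else 0)"
          unfolding \<Phi>_def sum_subtractf by simp
        finally show ?thesis by (auto simp: eB)
      qed
      have "(\<Sum>i<m. \<Phi> (mix {e} \<omega>) i *\<^sub>R x i)
        = (\<Sum>i<m. \<Phi> (mix {} \<omega>) i *\<^sub>R x i) - (\<Sum>i<m. if i = e div k then t e *\<^sub>R x i else 0)"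
        unfolding diff scaleR_diff_left sum_subtractf
        by (intro arg_cong2[of _ _ _ _ "(-)"] sum.cong) auto
      also have "\<dots> = (\<Sum>i<m. \<Phi> (mix {} \<omega>) i *\<^sub>R x i) - t e *\<^sub>R x (e div k)"
        using that by (simp add: ltmk)
      finally show ?thesis by (simp only: f_def F_def V_def add_diff_eq)
    qed
    have "(\<Sum>e<m * k. (max 0 (norm V - norm (V - t e *\<^sub>R x (e div k))))\<^sup>2) \<le> Z \<omega>"
    proof (rule sum_squares_decrease_le[OF contr])
      show "e < m * k \<Longrightarrow> e div k < m" for e by (simp add: ltmk)
      show "0 \<le> Z \<omega>" by (auto simp: Z_def intro!: add_nonneg_nonneg sum_nonneg)
      fix i assume i: "i < m"
      have "{e\<in>{..<m * k}. e div k = i} = B i" using i by (auto simp: eB ltmk)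
      then have "(\<Sum>e\<in>{e\<in>{..<m * k}. e div k = i}. (t e)\<^sup>2) = (\<Sum>e\<in>B i. (t e)\<^sup>2)" by simp
      also have "\<dots> \<le> (\<Sum>e\<in>B i. (2 / k) * ((\<omega> (e, False))\<^sup>2 + (\<omega> (e, True))\<^sup>2))"
      proof (rule sum_mono)
        fix e
        have "(a - b)\<^sup>2 \<le> 2 * (a\<^sup>2 + b\<^sup>2)" for a b :: real
          using zero_le_power2[of "a + b"] unfolding power2_sum power2_diff by argo
        then show "(t e)\<^sup>2 \<le> (2 / k) * ((\<omega> (e, False))\<^sup>2 + (\<omega> (e, True))\<^sup>2)"
          using k(2) by (simp add: t_def power_divide divide_right_mono)
      qed
      also have "\<dots> = (2 / k) * (Y i \<omega> + 2 * k)"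
      proof -
        have "Y i \<omega> = (\<Sum>e\<in>B i. (\<omega> (e, False))\<^sup>2 + (\<omega> (e, True))\<^sup>2 - 2)"
          unfolding Y_def sum.cartesian_product' UNIV_bool by (intro sum.cong) auto
        then show ?thesis
          unfolding sum_distrib_left[symmetric] by (simp only: sum_subtractf) (simp add: cardB)
      qed
      also have "\<dots> = 4 + 2 * (Y i \<omega> / k)" using k(2) by (simp add: field_simps)
      also have "\<dots> \<le> 5 + (Y i \<omega> / k)\<^sup>2"
        using zero_le_power2[of "Y i \<omega> / k - 1"] unfolding power2_diff by simp
      also have "\<dots> \<le> Z \<omega>"
        unfolding Z_def using i by (intro add_left_mono member_le_sum) auto
      finally show "(\<Sum>e\<in>{e\<in>{..<m * k}. e div k = i}. (t e)\<^sup>2) \<le> Z \<omega>" .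
    qed
    then show ?thesis by (simp add: f0 fe)
  qed
  have intY: "integrable gauss (\<lambda>\<omega>. (Y i \<omega> / k)\<^sup>2)" for i
    unfolding Y_def power_divide
    by (intro integrable_divide_zero sum_gauss_coord_square_dev(2) finite_cartesian_product) auto
  have EY: "(\<integral>\<omega>. (Y i \<omega> / k)\<^sup>2 \<partial>gauss) = 2 * coord_square_variance / k" for i
    unfolding Y_def power_divide integral_divide_zero
    by (subst sum_gauss_coord_square_dev(1)) (use k(2) in \<open>auto simp: cardBU power2_eq_square\<close>)
  have intZ: "integrable gauss Z" unfolding Z_def using intY by auto
  have intES: "integrable gauss (\<lambda>\<omega>. (max 0 (f (mix {} \<omega>) - f (mix {e} \<omega>)))\<^sup>2)" for e
    by (rule Efron_Stein(2)[OF f sqf dep])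
  have "(\<integral>s. (F s)\<^sup>2 \<partial>gauss) - (\<integral>s. F s \<partial>gauss)\<^sup>2 = (\<integral>\<omega>. (f \<omega>)\<^sup>2 \<partial>gauss) - (\<integral>\<omega>. f \<omega> \<partial>gauss)\<^sup>2"
    unfolding f_def by (subst (1 2) law(1)[symmetric]) auto
  also have "\<dots> \<le> (\<Sum>e<m * k. \<integral>\<omega>. (max 0 (f (mix {} \<omega>) - f (mix {e} \<omega>)))\<^sup>2 \<partial>gauss)"
    by (rule Efron_Stein(1)[OF f sqf dep])
  also have "\<dots> = (\<integral>\<omega>. (\<Sum>e<m * k. (max 0 (f (mix {} \<omega>) - f (mix {e} \<omega>)))\<^sup>2) \<partial>gauss)"
    using intES by (subst Bochner_Integration.integral_sum) auto
  also have "\<dots> \<le> (\<integral>\<omega>. Z \<omega> \<partial>gauss)"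
    using intES by (intro integral_mono intZ pointwise) auto
  also have "\<dots> = 5 + m * (2 * coord_square_variance / k)"
    unfolding Z_def using intY by (simp add: EY prob_space[simplified])
  also have "\<dots> \<le> 6" using k by (simp add: field_simps)
  finally show ?thesis .
qed

section \<open>Lower bounds for the mean by symmetry\<close>

lemma integral_gauss_sign:
  fixes f :: "('i::countable \<Rightarrow> real) \<Rightarrow> real"
  assumes "f \<in> borel_measurable borel" and c: "\<And>i. (c i)\<^sup>2 = 1"
  shows "(\<integral>\<omega>. f (\<lambda>i. c i * \<omega> i) \<partial>gauss) = (\<integral>\<omega>. f \<omega> \<partial>gauss)"
    and "integrable gauss (\<lambda>\<omega>. f (\<lambda>i. c i * \<omega> i)) \<longleftrightarrow> integrable gauss f"
  using integral_gauss_block[of "\<lambda>i. {i}" c f] assms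
  by (auto simp: disjoint_family_on_def)

text \<open>The unshifted norm is at most the average of the norms shifted by \<open>u\<close> and
  by \<open>- u\<close>, and these have equal means by the symmetry of the Gaussian law.\<close>

lemma expectation_norm_shift_ge:
  fixes x :: "nat \<Rightarrow> 'a::real_normed_vector" and u :: 'a
  assumes contr: "contractive m x"
  shows "(\<integral>s. norm (\<Sum>i<m. s i *\<^sub>R x i) \<partial>gauss) \<le> (\<integral>s. norm (u + (\<Sum>i<m. s i *\<^sub>R x i)) \<partial>gauss)"
proof -
  let ?N = "\<lambda>u s. norm (u + (\<Sum>i<m. s i *\<^sub>R x i))"
  have int: "integrable gauss (?N u)" for u
    by (rule integrable_norm_gauss_comb(2)[OF contr])
  have neg: "?N u (\<lambda>i. - 1 * s i) = ?N (- u) s" for s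
    by (simp add: sum_negf norm_minus_commute)
  have "(\<integral>s. ?N 0 s \<partial>gauss) \<le> (\<integral>s. (?N u s + ?N (- u) s) / 2 \<partial>gauss)"
  proof (intro integral_mono int)
    show "integrable gauss (\<lambda>s. (?N u s + ?N (- u) s) / 2)"
      by (intro integrable_divide_zero Bochner_Integration.integrable_add int)
    fix s :: "nat \<Rightarrow> real"
    have "norm (2 *\<^sub>R (\<Sum>i<m. s i *\<^sub>R x i)) \<le> ?N u s + ?N (- u) s"
      using norm_triangle_ineq[of "u + (\<Sum>i<m. s i *\<^sub>R x i)" "- u + (\<Sum>i<m. s i *\<^sub>R x i)"]
      by (simp add: scaleR_2)
    then show "?N 0 s \<le> (?N u s + ?N (- u) s) / 2" by simp
  qed
  also have "\<dots> = ((\<integral>s. ?N u s \<partial>gauss) + (\<integral>s. ?N (- u) s \<partial>gauss)) / 2"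
    unfolding integral_divide_zero by (subst Bochner_Integration.integral_add[OF int int]) simp
  also have "(\<integral>s. ?N (- u) s \<partial>gauss) = (\<integral>s. ?N u s \<partial>gauss)"
    using integral_gauss_sign(1)[of "?N u" "\<lambda>_. - 1"] unfolding neg by simp
  finally show ?thesis by simp
qed

text \<open>The density is positive on the whole tail beyond \<open>\<bar>t\<bar>\<close>.
  Strictness makes the powers of this probability tend to 0, so among many Gaussians one is likely
  to be large.\<close>

lemma std_normal_bounded_less_1:
  "measure std_normal_distribution {x. \<bar>x\<bar> \<le> t} < 1"
proof -
  interpret prob_space std_normal_distribution by (rule prob_space_normal_density) simp
  have pos: "0 < std_normal_density x" for x by (rule normal_density_pos) simp
  have "emeasure std_normal_distribution {\<bar>t\<bar><..} \<noteq> 0"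
  proof
    assume "emeasure std_normal_distribution {\<bar>t\<bar><..} = 0"
    then have "{\<bar>t\<bar><..} \<in> null_sets std_normal_distribution"
      by (simp add: null_setsI)
    then have "AE x in lborel. x \<notin> {\<bar>t\<bar><..}"
      by (subst (asm) null_sets_density_iff)
        (auto simp: ennreal_eq_0_iff not_le[THEN iffD2, OF pos] elim!: eventually_mono)
    then have "emeasure lborel {\<bar>t\<bar><..} = 0"
      by (subst (asm) AE_iff_measurable[of "{\<bar>t\<bar><..}"]) auto
    moreover have "emeasure lborel {\<bar>t\<bar><..<\<bar>t\<bar> + 1} \<le> emeasure lborel {\<bar>t\<bar><..}"
      by (intro emeasure_mono) auto
    ultimately show False by simp
  qed
  then have "0 < prob {\<bar>t\<bar><..}"
    by (simp add: emeasure_eq_measure less_le)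
  moreover have "prob {x. \<bar>x\<bar> \<le> t} + prob {\<bar>t\<bar><..} = prob ({x. \<bar>x\<bar> \<le> t} \<union> {\<bar>t\<bar><..})"
    by (intro finite_measure_Union[symmetric]) auto
  ultimately show ?thesis using prob_le_1[of "{x. \<bar>x\<bar> \<le> t} \<union> {\<bar>t\<bar><..}"] by linarith
qed

lemma measure_gauss_cube:
  "measure gauss {\<omega> :: nat \<Rightarrow> real. \<forall>i<m. \<bar>\<omega> i\<bar> \<le> t} = measure std_normal_distribution {x. \<bar>x\<bar> \<le> t} ^ m"
proof -
  interpret P: product_prob_space "\<lambda>_ :: nat. std_normal_distribution" UNIV
    by (intro product_prob_spaceI prob_space_normal_density) simp
  have "measure (PiM UNIV (\<lambda>_ :: nat. std_normal_distribution))
      (prod_emb UNIV (\<lambda>_. std_normal_distribution) {..<m} (PiE {..<m} (\<lambda>_. {x. \<bar>x\<bar> \<le> t})))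
    = (\<Prod>i<m. measure std_normal_distribution {x. \<bar>x\<bar> \<le> t})"
    by (rule P.measure_PiM_emb) auto
  moreover have "prod_emb UNIV (\<lambda>_ :: nat. std_normal_distribution) {..<m} (PiE {..<m} (\<lambda>_. {x. \<bar>x\<bar> \<le> t}))
    = {\<omega>. \<forall>i<m. \<bar>\<omega> i\<bar> \<le> t}"
    unfolding prod_emb_def by (rule Set.set_eqI) (simp add: restrict_PiE_iff Pi_iff Ball_def)
  ultimately show ?thesis by (simp add: gauss_def)
qed

text \<open>Flipping the signs of all coordinates but the \<open>i\<close>-th one and averaging isolates
  \<open>s i *\<^sub>R x i\<close>; it is applied on the event that \<open>i\<close> is the first index with \<open>t < \<bar>s i\<bar>\<close>.\<close>

lemma expectation_norm_gauss_ge: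
  fixes x :: "nat \<Rightarrow> 'a::real_normed_vector"
  assumes contr: "contractive m x"
    and low: "\<And>i. i < m \<Longrightarrow> c \<le> norm (x i)" and "0 \<le> c" "0 \<le> t"
  shows "t * c * (1 - measure std_normal_distribution {x. \<bar>x\<bar> \<le> t} ^ m)
    \<le> (\<integral>s. norm (\<Sum>i<m. s i *\<^sub>R x i) \<partial>gauss)"
proof -
  interpret prob_space "gauss :: (nat \<Rightarrow> real) measure" by (rule prob_space_gauss)
  let ?N = "\<lambda>s. norm (\<Sum>i<m. s i *\<^sub>R x i)"
  define E where "E i = {s :: nat \<Rightarrow> real. t < \<bar>s i\<bar> \<and> (\<forall>j<i. \<bar>s j\<bar> \<le> t)}" for i
  have E [measurable]: "E i \<in> sets borel" for i unfolding E_def by measurable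
  have N [measurable]: "?N \<in> borel_measurable borel"
    using borel_measurable_comb[where u = 0 and x = x and m = m] by simp
  have int: "integrable gauss ?N"
    using integrable_norm_gauss_comb(2)[OF contr, where u = 0] by simp
  have intE: "integrable gauss (\<lambda>s. indicator (E i) s * ?N s)" for i
    using integrable_real_mult_indicator[OF _ int, of "E i"] by (simp add: mult.commute)
  have disj: "disjoint_family E"
  proof (unfold disjoint_family_on_def, intro ballI impI)
    fix i j :: nat assume "i \<noteq> j"
    then show "E i \<inter> E j = {}"
      by (cases i j rule: linorder_cases) (fastforce simp: E_def)+
  qed
  have one: "t * c * prob (E i) \<le> (\<integral>s. indicator (E i) s * ?N s \<partial>gauss)" if "i < m" for i
  proof -
    define \<sigma> where "\<sigma> j = (if j = i then 1 else - 1 :: real)" for j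
    define g where "g s = indicator (E i) s * ?N s" for s
    have g [measurable]: "g \<in> borel_measurable borel" unfolding g_def by measurable
    have \<sigma>: "(\<sigma> j)\<^sup>2 = 1" for j by (simp add: \<sigma>_def)
    have intg: "integrable gauss g" unfolding g_def by (rule intE)
    have intg': "integrable gauss (\<lambda>s. g (\<lambda>j. \<sigma> j * s j))"
      using integral_gauss_sign(2)[OF g \<sigma>] intg by simp
    have "t * c * prob (E i) = (\<integral>s. t * c * indicator (E i) s \<partial>gauss)" by simp
    also have "\<dots> \<le> (\<integral>s. (g s + g (\<lambda>j. \<sigma> j * s j)) / 2 \<partial>gauss)"
    proof (rule integral_mono)
      show "integrable gauss (\<lambda>s. t * c * indicator (E i) s :: real)"
        by (intro integrable_mult_right integrable_real_indicator) (auto simp: less_top[symmetric])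
      show "integrable gauss (\<lambda>s. (g s + g (\<lambda>j. \<sigma> j * s j)) / 2)"
        using intg intg' by simp
      fix s :: "nat \<Rightarrow> real"
      \<comment> \<open>The event depends only on absolute values, so it survives the sign
        flips.\<close>
      have E': "(\<lambda>j. \<sigma> j * s j) \<in> E i \<longleftrightarrow> s \<in> E i" by (auto simp: E_def \<sigma>_def)
      have "(\<Sum>j<m. s j *\<^sub>R x j) + (\<Sum>j<m. (\<sigma> j * s j) *\<^sub>R x j) = (\<Sum>j<m. if j = i then (2 * s i) *\<^sub>R x i else 0)"
        unfolding sum.distrib[symmetric]
        by (intro sum.cong) (auto simp: \<sigma>_def scaleR_add_left[symmetric])
      also have "\<dots> = (2 * s i) *\<^sub>R x i" using that by simp
      finally have "norm ((2 * s i) *\<^sub>R x i) \<le> ?N s + ?N (\<lambda>j. \<sigma> j * s j)"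
        by (metis norm_triangle_ineq)
      then have *: "\<bar>s i\<bar> * norm (x i) \<le> (?N s + ?N (\<lambda>j. \<sigma> j * s j)) / 2"
        by (simp add: abs_mult)
      have "t * c \<le> (?N s + ?N (\<lambda>j. \<sigma> j * s j)) / 2" if "s \<in> E i"
      proof -
        have "t * c \<le> \<bar>s i\<bar> * norm (x i)"
          using that low[OF \<open>i < m\<close>] \<open>0 \<le> c\<close> \<open>0 \<le> t\<close> by (intro mult_mono) (auto simp: E_def)
        then show ?thesis using * by linarith
      qed
      then show "t * c * indicator (E i) s \<le> (g s + g (\<lambda>j. \<sigma> j * s j)) / 2"
        by (auto simp: g_def E' indicator_def)
    qed
    also have "\<dots> = (\<integral>s. g s \<partial>gauss)"
      using intg intg' integral_gauss_sign(1)[OF g \<sigma>] by simp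
    finally show ?thesis by (simp add: g_def)
  qed
  have ind: "(\<Sum>i<m. indicator (E i) s) \<le> (1 :: real)" for s
  proof -
    have "(\<Sum>i<m. indicator (E i) s) = (indicator (\<Union>i<m. E i) s :: real)"
      using disj by (subst indicator_UN_disjoint) (auto simp: disjoint_family_on_def)
    then show ?thesis by (simp add: indicator_def)
  qed
  have "UNIV - {s. \<forall>i<m. \<bar>s i\<bar> \<le> t} = (\<Union>i<m. E i)"
  proof (intro Set.set_eqI iffI)
    fix s :: "nat \<Rightarrow> real" assume "s \<in> UNIV - {s. \<forall>i<m. \<bar>s i\<bar> \<le> t}"
    then obtain i where i: "i < m" "t < \<bar>s i\<bar>" by auto
    define l where "l = (LEAST i. t < \<bar>s i\<bar>)"
    have "t < \<bar>s l\<bar>" unfolding l_def by (rule LeastI[of _ i]) (rule i)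
    moreover have "l \<le> i" unfolding l_def by (rule Least_le) (rule i)
    moreover have "\<bar>s j\<bar> \<le> t" if "j < l" for j
      using not_less_Least[of j "\<lambda>i. t < \<bar>s i\<bar>"] that by (simp add: l_def not_less)
    ultimately show "s \<in> (\<Union>i<m. E i)" using i by (auto simp: E_def)
  qed (auto simp: E_def not_le)
  moreover have "{s :: nat \<Rightarrow> real. \<forall>i<m. \<bar>s i\<bar> \<le> t} \<in> sets gauss" by measurable
  ultimately have "1 - measure std_normal_distribution {x. \<bar>x\<bar> \<le> t} ^ m = prob (\<Union>i<m. E i)"
    using prob_compl[of "{s. \<forall>i<m. \<bar>s i\<bar> \<le> t}"] by (simp add: measure_gauss_cube)
  also have "\<dots> = (\<Sum>i<m. prob (E i))"
    using disj by (intro finite_measure_finite_Union) (auto simp: disjoint_family_on_def)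
  finally have "t * c * (1 - measure std_normal_distribution {x. \<bar>x\<bar> \<le> t} ^ m) = (\<Sum>i<m. t * c * prob (E i))"
    by (simp add: sum_distrib_left)
  also have "\<dots> \<le> (\<Sum>i<m. \<integral>s. indicator (E i) s * ?N s \<partial>gauss)"
    by (intro sum_mono one) auto
  also have "\<dots> = (\<integral>s. (\<Sum>i<m. indicator (E i) s) * ?N s \<partial>gauss)"
    using intE by (subst Bochner_Integration.integral_sum[symmetric]) (auto simp: sum_distrib_right)
  also have "\<dots> \<le> (\<integral>s. ?N s \<partial>gauss)"
  proof (rule integral_mono[OF _ int])
    show "integrable gauss (\<lambda>s. (\<Sum>i<m. indicator (E i) s) * ?N s)"
      unfolding sum_distrib_right by (intro Bochner_Integration.integrable_sum intE)
    show "(\<Sum>i<m. indicator (E i) s) * ?N s \<le> ?N s" for s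
      using mult_right_mono[OF ind, of "?N s" s] by simp
  qed
  finally show ?thesis .
qed

section \<open>Deviation probabilities\<close>

text \<open>The shifted mean is at least \<open>A\<close>, so a bad outcome deviates by
  \<open>A / 2\<close> in the shifted norm or by \<open>A\<close> in the unshifted one. With
  variance at most 6, Chebyshev gives \<open>24 / A\<^sup>2 + 6 / A\<^sup>2\<close>.\<close>

lemma prob_norm_gauss_comb:
  fixes x :: "nat \<Rightarrow> 'a::real_normed_vector"
  assumes contr: "contractive m x"
  defines "A \<equiv> \<integral>s. norm (\<Sum>i<m. s i *\<^sub>R x i) \<partial>gauss"
  assumes A: "0 < A"
  shows "measure gauss {s. norm (u + (\<Sum>i<m. s i *\<^sub>R x i)) < A / 2 \<or> 2 * A < norm (\<Sum>i<m. s i *\<^sub>R x i)} \<le> 30 / A\<^sup>2"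
proof -
  interpret prob_space "gauss :: (nat \<Rightarrow> real) measure" by (rule prob_space_gauss)
  have cheb: "prob {s. a \<le> \<bar>norm (u + (\<Sum>i<m. s i *\<^sub>R x i)) - (\<integral>s. norm (u + (\<Sum>i<m. s i *\<^sub>R x i)) \<partial>gauss)\<bar>} \<le> 6 / a\<^sup>2"
    if "0 < a" for a u
  proof -
    let ?F = "\<lambda>s. norm (u + (\<Sum>i<m. s i *\<^sub>R x i))"
    have v: "variance ?F = (\<integral>s. (?F s)\<^sup>2 \<partial>gauss) - (\<integral>s. ?F s \<partial>gauss)\<^sup>2"
      by (rule variance_eq) (rule integrable_norm_gauss_comb[OF contr])+
    have "prob {s\<in>space gauss. a \<le> \<bar>?F s - expectation ?F\<bar>} \<le> variance ?F / a\<^sup>2"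
      by (rule Chebyshev_inequality[OF _ _ that]) (measurable, rule integrable_norm_gauss_comb(1)[OF contr])
    also have "\<dots> \<le> 6 / a\<^sup>2"
      unfolding v by (rule divide_right_mono[OF variance_norm_gauss_comb[OF contr] zero_le_power2])
    finally show ?thesis unfolding space_gauss by (simp only: UNIV_I simp_thms)
  qed
  let ?D = "\<lambda>a u. {s. a \<le> \<bar>norm (u + (\<Sum>i<m. s i *\<^sub>R x i)) - (\<integral>s. norm (u + (\<Sum>i<m. s i *\<^sub>R x i)) \<partial>gauss)\<bar>}"
  have sub: "{s. norm (u + (\<Sum>i<m. s i *\<^sub>R x i)) < A / 2 \<or> 2 * A < norm (\<Sum>i<m. s i *\<^sub>R x i)}
      \<subseteq> ?D (A / 2) u \<union> ?D A 0"
  proof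
    fix s assume s: "s \<in> {s. norm (u + (\<Sum>i<m. s i *\<^sub>R x i)) < A / 2 \<or> 2 * A < norm (\<Sum>i<m. s i *\<^sub>R x i)}"
    have "A \<le> (\<integral>s. norm (u + (\<Sum>i<m. s i *\<^sub>R x i)) \<partial>gauss)"
      unfolding A_def by (rule expectation_norm_shift_ge[OF contr])
    moreover have "(\<integral>s. norm (0 + (\<Sum>i<m. s i *\<^sub>R x i)) \<partial>gauss) = A"
      unfolding A_def by (simp only: add_0)
    moreover have "norm (0 + (\<Sum>i<m. s i *\<^sub>R x i)) = norm (\<Sum>i<m. s i *\<^sub>R x i)" by simp
    ultimately show "s \<in> ?D (A / 2) u \<union> ?D A 0"
      using s A unfolding Un_iff mem_Collect_eq by linarith
  qed
  have meas: "(\<lambda>s. norm (u + (\<Sum>i<m. s i *\<^sub>R x i))) \<in> borel_measurable gauss" for u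
    using borel_measurable_comb[of u x m] by (simp cong: measurable_cong_sets)
  have "{s \<in> space gauss. a \<le> \<bar>norm (u + (\<Sum>i<m. s i *\<^sub>R x i)) - c\<bar>} \<in> events" for a u c
    by (rule borel_measurable_le)
      (rule borel_measurable_const borel_measurable_abs borel_measurable_diff meas)+
  then have D: "?D a u \<in> events" for a u by (simp only: space_gauss UNIV_I simp_thms)
  have "prob {s. norm (u + (\<Sum>i<m. s i *\<^sub>R x i)) < A / 2 \<or> 2 * A < norm (\<Sum>i<m. s i *\<^sub>R x i)}
    \<le> prob (?D (A / 2) u \<union> ?D A 0)"
    by (rule finite_measure_mono[OF sub]) (intro sets.Un D)
  also have "\<dots> \<le> prob (?D (A / 2) u) + prob (?D A 0)"
    by (intro measure_Un_le D)
  also have "\<dots> \<le> 6 / (A / 2)\<^sup>2 + 6 / A\<^sup>2"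
    by (rule add_mono; rule cheb) (use A in simp_all)
  also have "\<dots> = 30 / A\<^sup>2" using A by (simp add: field_simps power2_eq_square)
  finally show ?thesis .
qed

section \<open>A finite form of Dvoretzky's theorem\<close>

text \<open>Gram--Schmidt, removal of the zero vector and normalisation give an orthonormal basis of
  the span; Parseval's identity is the form in which it is applied.\<close>

lemma finite_orthonormal_basis:
  fixes W :: "'h::real_inner set"
  assumes "finite W"
  obtains e :: "nat \<Rightarrow> 'h" and n
  where "\<And>z. z \<in> W \<Longrightarrow> (\<Sum>j<n. (z \<bullet> e j)\<^sup>2) = (norm z)\<^sup>2"
proof -
  from basis_orthogonal[OF assms] obtain C where C: "finite C" "span C = span W" "pairwise real_inner_class.orthogonal C"
    by blast
  define D where "D = C - {0}"
  have D: "finite D" "pairwise real_inner_class.orthogonal D" "0 \<notin> D"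
    using C by (auto simp: D_def pairwise_def)
  have spanD: "span D = span W" using C(2) by (simp add: D_def span_delete_0)
  obtain c where c: "bij_betw c {..<card D} D"
    using ex_bij_betw_nat_finite[OF D(1)] by (auto simp: lessThan_atLeast0)
  have "(\<Sum>j<card D. (z \<bullet> ((1 / norm (c j)) *\<^sub>R c j))\<^sup>2) = (norm z)\<^sup>2" if "z \<in> W" for z
  proof -
    have "z \<in> span D" using that by (simp add: spanD span_base)
    then obtain q where q: "z = (\<Sum>d\<in>D. q d *\<^sub>R d)"
      by (auto simp: span_finite[OF D(1)])
    have inner: "z \<bullet> d = q d * (norm d)\<^sup>2" if "d \<in> D" for d
    proof -
      have "z \<bullet> d = (\<Sum>d'\<in>D. if d' = d then q d * (norm d)\<^sup>2 else 0)"
        unfolding q inner_sum_left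
        using D(2) that by (intro sum.cong) (auto simp: pairwise_def real_inner_class.orthogonal_def power2_norm_eq_inner)
      then show ?thesis using D(1) that by simp
    qed
    have "(\<Sum>j<card D. (z \<bullet> ((1 / norm (c j)) *\<^sub>R c j))\<^sup>2) = (\<Sum>d\<in>D. (z \<bullet> ((1 / norm d) *\<^sub>R d))\<^sup>2)"
      by (rule sum.reindex_bij_betw[OF c])
    also have "\<dots> = (\<Sum>d\<in>D. (q d)\<^sup>2 * (norm d)\<^sup>2)"
      using D(3) by (intro sum.cong) (auto simp: inner power2_eq_square)
    also have "\<dots> = (\<Sum>d\<in>D. q d * (z \<bullet> d))"
      by (intro sum.cong) (auto simp: inner power2_eq_square)
    also have "\<dots> = (norm z)\<^sup>2"
      unfolding power2_norm_eq_inner by (subst (3) q) (simp add: inner_sum_right)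
    finally show ?thesis .
  qed
  then show ?thesis by (rule that)
qed

text \<open>The threshold \<open>8 * R\<close>, the norms at least \<open>1 / 4\<close> and a
  probability above \<open>1 / 2\<close> of some coefficient exceeding the threshold multiply to
  \<open>R\<close>.\<close>

lemma exists_contractive_large_mean:
  assumes "\<not> finite_dimensional (UNIV :: 'a::real_normed_vector set)" and "0 < R"
  obtains m and x :: "nat \<Rightarrow> 'a::real_normed_vector"
  where "contractive m x" "R \<le> (\<integral>s. norm (\<Sum>i<m. s i *\<^sub>R x i) \<partial>gauss)"
proof -
  let ?p = "measure std_normal_distribution {x. \<bar>x\<bar> \<le> 8 * R}"
  obtain m where "?p ^ m < 1 / 2"
    using real_arch_pow_inv[of "1 / 2" ?p] std_normal_bounded_less_1[of "8 * R"] by auto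
  then have R: "R \<le> 8 * R * (1 / 4) * (1 - ?p ^ m)"
    using \<open>0 < R\<close> by (simp add: field_simps)
  obtain x :: "nat \<Rightarrow> 'a" where x: "contractive m x" "\<And>i. i < m \<Longrightarrow> 1 / 4 \<le> norm (x i)"
    using Dvoretzky_Rogers[OF assms(1)] by blast
  have "8 * R * (1 / 4) * (1 - ?p ^ m) \<le> (\<integral>s. norm (\<Sum>i<m. s i *\<^sub>R x i) \<partial>gauss)"
    by (rule expectation_norm_gauss_ge[OF x]) (use \<open>0 < R\<close> in auto)
  with R have "R \<le> (\<integral>s. norm (\<Sum>i<m. s i *\<^sub>R x i) \<partial>gauss)" by linarith
  with x(1) show ?thesis by (rule that)
qed

text \<open>A Gaussian matrix applied to a fixed unit vector has independent standard normal
  entries, so every pair in \<open>S\<close> with \<open>z\<close> nonzero obeys the deviation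
  bound. A union bound leaves an outcome that is good for all of them at once.\<close>

lemma finite_Dvoretzky:
  fixes S :: "('x::real_normed_vector \<times> 'h::real_inner) set"
  assumes inf: "\<not> finite_dimensional (UNIV :: 'x set)"
    and S: "finite S"
  shows "\<exists>T :: 'h \<Rightarrow> 'x. linear T \<and> (\<forall>(u, z)\<in>S. norm (T z) \<le> 2 * norm z \<and> norm z / 2 \<le> norm (u + T z))"
proof -
  \<comment> \<open>Adding 1 gives both \<open>R > 30 * card S\<close> and \<open>R \<ge> 1\<close>,
    hence \<open>R\<^sup>2 > 30 * card S\<close>, as the union bound demands.\<close>
  define R where "R = 30 * real (card S) + 1"
  have R: "0 < R" "30 * real (card S) < R\<^sup>2"
  proof -
    show "0 < R" by (simp add: R_def)
    have "30 * real (card S) < R * 1" by (simp add: R_def)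
    also have "\<dots> \<le> R * R" by (intro mult_left_mono) (auto simp: R_def)
    finally show "30 * real (card S) < R\<^sup>2" by (simp add: power2_eq_square)
  qed
  obtain m and x :: "nat \<Rightarrow> 'x" where contr: "contractive m x"
    and RA: "R \<le> (\<integral>s. norm (\<Sum>i<m. s i *\<^sub>R x i) \<partial>gauss)"
    using exists_contractive_large_mean[OF inf R(1)] by blast
  define A where "A = (\<integral>s. norm (\<Sum>i<m. s i *\<^sub>R x i) \<partial>gauss)"
  have RA: "R \<le> A" using RA by (simp add: A_def)
  then have A: "0 < A" using R by linarith
  have "finite (snd ` S)" using S by simp
  from finite_orthonormal_basis[OF this] obtain e :: "nat \<Rightarrow> 'h" and n
    where e: "\<And>z. z \<in> snd ` S \<Longrightarrow> (\<Sum>j<n. (z \<bullet> e j)\<^sup>2) = (norm z)\<^sup>2" by blast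
  define \<Phi> where "\<Phi> z \<omega> = (\<lambda>i. \<Sum>p\<in>{i} \<times> {..<n}. (z \<bullet> e (snd p) / norm z) * \<omega> p)"
    for z and \<omega> :: "nat \<times> nat \<Rightarrow> real"
  define T where "T \<omega> z = (1 / A) *\<^sub>R (\<Sum>i<m. (\<Sum>j<n. (z \<bullet> e j) * \<omega> (i, j)) *\<^sub>R x i)"
    for \<omega> :: "nat \<times> nat \<Rightarrow> real" and z
  have T\<Phi>: "(\<Sum>i<m. \<Phi> z \<omega> i *\<^sub>R x i) = (A / norm z) *\<^sub>R T \<omega> z" for z \<omega>
  proof -
    have "\<Phi> z \<omega> i = (1 / norm z) * (\<Sum>j<n. (z \<bullet> e j) * \<omega> (i, j))" for i
      unfolding \<Phi>_def sum.cartesian_product' by (simp add: sum_divide_distrib)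
    then show ?thesis
      using A by (simp only: scaleR_scaleR[symmetric] scaleR_sum_right[symmetric]) (simp add: T_def)
  qed
  \<comment> \<open>The shift is scaled by \<open>A / norm (snd p)\<close> like the combination
    itself, so that avoiding \<open>bad p\<close> is the desired estimate after homogeneous
    rescaling.\<close>
  define bad where "bad p = {\<omega>. norm ((A / norm (snd p)) *\<^sub>R fst p + (\<Sum>i<m. \<Phi> (snd p) \<omega> i *\<^sub>R x i)) < A / 2
      \<or> 2 * A < norm (\<Sum>i<m. \<Phi> (snd p) \<omega> i *\<^sub>R x i)}" for p
  interpret prob_space "gauss :: (nat \<times> nat \<Rightarrow> real) measure" by (rule prob_space_gauss)
  have bad: "bad p \<in> events \<and> prob (bad p) \<le> 30 / A\<^sup>2" if p: "p \<in> S" "snd p \<noteq> 0" for p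
  proof -
    obtain u z where uz: "p = (u, z)" by (cases p)
    let ?B = "{s. norm ((A / norm z) *\<^sub>R u + (\<Sum>i<m. s i *\<^sub>R x i)) < A / 2 \<or> 2 * A < norm (\<Sum>i<m. s i *\<^sub>R x i)}"
    have B: "?B \<in> sets borel"
    proof -
      have "(\<lambda>s. norm ((A / norm z) *\<^sub>R u + (\<Sum>i<m. s i *\<^sub>R x i))) \<in> borel_measurable borel"
        by (rule borel_measurable_comb)
      moreover have "(\<lambda>s. norm (\<Sum>i<m. s i *\<^sub>R x i)) \<in> borel_measurable borel"
        using borel_measurable_comb[of 0 x m] by simp
      ultimately have "{s \<in> space borel. norm ((A / norm z) *\<^sub>R u + (\<Sum>i<m. s i *\<^sub>R x i)) < A / 2} \<union>
          {s \<in> space borel. 2 * A < norm (\<Sum>i<m. s i *\<^sub>R x i)} \<in> sets borel"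
        by (intro sets.Un borel_measurable_less borel_measurable_const)
      then show ?thesis by (simp add: Un_def)
    qed
    have \<Phi>m: "\<Phi> z \<in> measurable gauss gauss"
      unfolding \<Phi>_def
      by (subst measurable_cong_sets[OF refl sets_gauss], rule measurable_coordinatewise_then_product)
        measurable
    have "distr gauss gauss (\<Phi> z) = gauss"
      unfolding \<Phi>_def
    proof (rule distr_gauss_block)
      show "disjoint_family (\<lambda>i. {i} \<times> {..<n})" by (auto simp: disjoint_family_on_def)
      fix i :: nat
      show "finite ({i} \<times> {..<n})" by simp
      have "(\<Sum>j\<in>{i} \<times> {..<n}. (z \<bullet> e (snd j) / norm z)\<^sup>2) = (\<Sum>j<n. (z \<bullet> e j)\<^sup>2) / (norm z)\<^sup>2"
        unfolding sum.cartesian_product' by (simp add: power_divide sum_divide_distrib)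
      also have "\<dots> = 1"
        using p e[of z] uz by (auto simp: image_iff) (metis snd_conv)
      finally show "(\<Sum>j\<in>{i} \<times> {..<n}. (z \<bullet> e (snd j) / norm z)\<^sup>2) = 1" .
    qed
    then have "measure gauss ?B = measure (distr gauss gauss (\<Phi> z)) ?B" by simp
    also have "\<dots> = prob (\<Phi> z -` ?B \<inter> space gauss)"
      by (rule measure_distr[OF \<Phi>m]) (unfold sets_gauss, rule B)
    also have "\<Phi> z -` ?B \<inter> space gauss = bad p" by (auto simp: bad_def uz)
    finally have "prob (bad p) = measure gauss ?B" ..
    also have "\<dots> \<le> 30 / A\<^sup>2"
      using prob_norm_gauss_comb[OF contr] A unfolding A_def by simp
    finally have "prob (bad p) \<le> 30 / A\<^sup>2" .
    moreover have "\<Phi> z -` ?B \<inter> space gauss \<in> events"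
      by (rule measurable_sets[OF \<Phi>m]) (unfold sets_gauss, rule B)
    ultimately show ?thesis using \<open>\<Phi> z -` ?B \<inter> space gauss = bad p\<close> by simp
  qed
  let ?S = "{p \<in> S. snd p \<noteq> 0}"
  have "prob (\<Union>p\<in>?S. bad p) \<le> (\<Sum>p\<in>?S. prob (bad p))"
    using S bad by (intro finite_measure_subadditive_finite) auto
  also have "\<dots> \<le> real (card ?S) * (30 / A\<^sup>2)"
    using bad by (intro sum_bounded_above) auto
  also have "\<dots> \<le> real (card S) * (30 / A\<^sup>2)"
    using S by (intro mult_right_mono) (auto intro: card_mono)
  also have "\<dots> < 1"
  proof -
    have "R\<^sup>2 \<le> A\<^sup>2" using RA R by (intro power_mono) auto
    then have "30 * real (card S) < A\<^sup>2" using R by linarith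
    then show ?thesis using A by (simp add: divide_less_eq mult.commute)
  qed
  finally have "(\<Union>p\<in>?S. bad p) \<noteq> UNIV" using prob_space by auto
  then obtain \<omega> where \<omega>: "\<And>p. p \<in> S \<Longrightarrow> snd p \<noteq> 0 \<Longrightarrow> \<omega> \<notin> bad p" by blast
  have lin: "linear (T \<omega>)"
  proof (rule linearI)
    show "T \<omega> (a + b) = T \<omega> a + T \<omega> b" for a b
      by (simp add: T_def inner_add_left distrib_right sum.distrib scaleR_add_left scaleR_add_right)
    show "T \<omega> (r *\<^sub>R a) = r *\<^sub>R T \<omega> a" for r a
      by (simp add: T_def scaleR_sum_right sum_distrib_left mult_ac)
  qed
  moreover have "norm (T \<omega> z) \<le> 2 * norm z \<and> norm z / 2 \<le> norm (u + T \<omega> z)" if "(u, z) \<in> S" for u z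
  proof (cases "z = 0")
    case True
    then show ?thesis by (simp add: linear_0[OF lin])
  next
    case False
    have z: "0 < norm z" using False by simp
    have "\<omega> \<notin> bad (u, z)" using \<omega>[OF that] False by simp
    then have *: "A / 2 \<le> norm ((A / norm z) *\<^sub>R u + (A / norm z) *\<^sub>R T \<omega> z)"
      "norm ((A / norm z) *\<^sub>R T \<omega> z) \<le> 2 * A"
      by (auto simp: bad_def T\<Phi> not_less)
    have "norm ((A / norm z) *\<^sub>R u + (A / norm z) *\<^sub>R T \<omega> z) = (A / norm z) * norm (u + T \<omega> z)"
      using A z by (simp add: scaleR_add_right[symmetric] del: scaleR_add_right)
    then have "A / 2 \<le> (A / norm z) * norm (u + T \<omega> z)" using *(1) by simp
    moreover have "(A / norm z) * norm (T \<omega> z) \<le> 2 * A" using *(2) A z by simp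
    ultimately show ?thesis using A z by (simp add: field_simps)
  qed
  ultimately show ?thesis by (intro exI[of _ "T \<omega>"]) auto
qed

section \<open>Gluing along dyadic shells\<close>

text \<open>A ramp that is 1 up to \<open>2 ^ k\<close>, 0 from \<open>2 ^ Suc k\<close> on, and
  linear between.\<close>

definition cutoff :: "nat \<Rightarrow> real \<Rightarrow> real" where
  "cutoff k t = max 0 (min 1 (2 - t / 2 ^ k))"

text \<open>Differences of consecutive ramps, so that partial sums telescope. For positive
  \<open>k\<close> the bump lives between \<open>2 ^ (k - 1)\<close> and
  \<open>2 ^ Suc k\<close>.\<close>

definition dyadic_bump :: "nat \<Rightarrow> real \<Rightarrow> real" where
  "dyadic_bump k t = cutoff k t - (case k of 0 \<Rightarrow> 0 | Suc l \<Rightarrow> cutoff l t)"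

lemma cutoff_lipschitz: "\<bar>cutoff k s - cutoff k t\<bar> \<le> \<bar>s - t\<bar> / 2 ^ k"
proof -
  have "\<bar>max 0 (min 1 a) - max 0 (min 1 b)\<bar> \<le> \<bar>a - b\<bar>" for a b :: real by auto
  from this[of "2 - s / 2 ^ k" "2 - t / 2 ^ k"] show ?thesis
    by (simp add: cutoff_def diff_divide_distrib[symmetric] abs_minus_commute)
qed

lemma cutoff_eq_1: "t \<le> 2 ^ k \<Longrightarrow> cutoff k t = 1"
  by (simp add: cutoff_def)

lemma cutoff_eq_0:
  assumes "2 ^ Suc k \<le> t"
  shows "cutoff k t = 0"
proof -
  have "2 \<le> t / 2 ^ k" using assms by (simp add: pos_le_divide_eq)
  then show ?thesis by (simp add: cutoff_def)
qed

lemma dyadic_bump_eq_0: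
  assumes "2 ^ Suc k \<le> t \<or> (0 < k \<and> 2 * t \<le> 2 ^ k)"
  shows "dyadic_bump k t = 0"
proof (cases k)
  case 0
  then show ?thesis using assms by (auto simp: dyadic_bump_def intro: cutoff_eq_0)
next
  case (Suc l)
  have "(2 :: real) ^ l \<le> 2 ^ Suc l" "(2 :: real) ^ Suc l \<le> 2 ^ Suc (Suc l)"
    by (intro power_increasing; simp)+
  note pow = this
  have "cutoff (Suc l) t = cutoff l t"
  proof (cases "2 ^ Suc (Suc l) \<le> t")
    case True
    then have "2 ^ Suc l \<le> t" using pow(2) by linarith
    then show ?thesis using True by (simp only: cutoff_eq_0)
  next
    case False
    then have le: "t \<le> 2 ^ l" using assms Suc by auto
    then have "t \<le> 2 ^ Suc l" using pow(1) by linarith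
    with le show ?thesis by (simp only: cutoff_eq_1)
  qed
  then show ?thesis by (simp add: dyadic_bump_def Suc)
qed

lemma sum_dyadic_bump: "(\<Sum>k<Suc n. dyadic_bump k t) = cutoff n t"
  by (induction n) (auto simp: dyadic_bump_def)

lemma abs_dyadic_bump_le: "\<bar>dyadic_bump k t\<bar> \<le> 1"
  by (auto simp: dyadic_bump_def cutoff_def split: nat.split)

lemma dyadic_bump_lipschitz: "\<bar>dyadic_bump k s - dyadic_bump k t\<bar> \<le> 3 * \<bar>s - t\<bar> / 2 ^ k"
proof (cases k)
  case 0
  then show ?thesis using cutoff_lipschitz[of 0 s t] abs_ge_zero[of "s - t"] by (auto simp: dyadic_bump_def simp del: abs_ge_zero)
next
  case (Suc l)
  have eq: "dyadic_bump k u = cutoff k u - cutoff l u" for u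
    by (simp add: dyadic_bump_def Suc)
  have "\<bar>s - t\<bar> / 2 ^ l = 2 * (\<bar>s - t\<bar> / 2 ^ k)" by (simp add: Suc)
  moreover have "3 * \<bar>s - t\<bar> / 2 ^ k = 3 * (\<bar>s - t\<bar> / 2 ^ k)" by simp
  ultimately show ?thesis
    using cutoff_lipschitz[of k s t] cutoff_lipschitz[of l s t] unfolding eq by linarith
qed

text \<open>If \<open>p\<close> is the least active index, then \<open>t < 2 ^ Suc p\<close>, and
  every bump of index at least \<open>p + 2\<close> vanishes there.\<close>

lemma dyadic_bump_support:
  "\<exists>p. {k. dyadic_bump k t \<noteq> 0} \<subseteq> {p, Suc p}"
proof (cases "{k. dyadic_bump k t \<noteq> 0} = {}")
  case False
  define p where "p = (LEAST k. dyadic_bump k t \<noteq> 0)"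
  have p: "dyadic_bump p t \<noteq> 0"
    using False unfolding p_def by (metis (mono_tags, lifting) LeastI empty_Collect_eq)
  have "k \<in> {p, Suc p}" if "dyadic_bump k t \<noteq> 0" for k
  proof -
    have "p \<le> k" unfolding p_def using that by (rule Least_le)
    moreover have "k \<le> Suc p"
    proof (rule ccontr)
      assume "\<not> k \<le> Suc p"
      then have "Suc (Suc p) \<le> k" by simp
      then have "(2 :: real) ^ Suc (Suc p) \<le> 2 ^ k" by (intro power_increasing) auto
      moreover have "t < 2 ^ Suc p" using p dyadic_bump_eq_0[of p t] by (meson not_le)
      ultimately have "2 * t \<le> 2 ^ k" by simp
      then show False using dyadic_bump_eq_0[of k t] that \<open>Suc (Suc p) \<le> k\<close> by auto
    qed
    ultimately show ?thesis by auto
  qed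
  then show ?thesis by blast
qed auto

definition dyadic_part :: "nat \<Rightarrow> 'h::real_normed_vector \<Rightarrow> 'h" where
  "dyadic_part k x = dyadic_bump k (norm x) *\<^sub>R x"

text \<open>A product rule with the bump bounded by 1 and of slope \<open>3 / 2 ^ k\<close>,
  multiplied by the smaller norm, below \<open>2 ^ Suc k\<close>: this gives
  \<open>1 + 6 = 7\<close>. If even the smaller norm reaches \<open>2 ^ Suc k\<close>, both parts
  vanish.\<close>

lemma dyadic_part_lipschitz:
  "norm (dyadic_part k x - dyadic_part k y) \<le> 7 * norm (x - y)"
proof -
  have *: "norm (dyadic_part k x - dyadic_part k y) \<le> 7 * norm (x - y)" if "norm y \<le> norm x" for x y :: 'a
  proof (cases "2 ^ Suc k \<le> norm y")
    case True
    then show ?thesis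
      using that dyadic_bump_eq_0[of k "norm x"] dyadic_bump_eq_0[of k "norm y"]
      by (simp add: dyadic_part_def)
  next
    case False
    have "dyadic_part k x - dyadic_part k y
      = dyadic_bump k (norm x) *\<^sub>R (x - y) + (dyadic_bump k (norm x) - dyadic_bump k (norm y)) *\<^sub>R y"
      by (simp add: dyadic_part_def algebra_simps)
    then have "norm (dyadic_part k x - dyadic_part k y)
      \<le> \<bar>dyadic_bump k (norm x)\<bar> * norm (x - y) + \<bar>dyadic_bump k (norm x) - dyadic_bump k (norm y)\<bar> * norm y"
      using norm_triangle_ineq by (metis norm_scaleR)
    also have "\<dots> \<le> 1 * norm (x - y) + (3 * norm (x - y) / 2 ^ k) * 2 ^ Suc k"
    proof (intro add_mono mult_mono abs_dyadic_bump_le)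
      have "\<bar>dyadic_bump k (norm x) - dyadic_bump k (norm y)\<bar> \<le> 3 * \<bar>norm x - norm y\<bar> / 2 ^ k"
        by (rule dyadic_bump_lipschitz)
      also have "\<dots> \<le> 3 * norm (x - y) / 2 ^ k"
        by (intro divide_right_mono mult_left_mono norm_triangle_ineq3) auto
      finally show "\<bar>dyadic_bump k (norm x) - dyadic_bump k (norm y)\<bar> \<le> 3 * norm (x - y) / 2 ^ k" .
    qed (use False in auto)
    also have "\<dots> = 7 * norm (x - y)" by simp
    finally show ?thesis .
  qed
  show ?thesis
    using *[of x y] *[of y x] by (metis linear norm_minus_commute)
qed

lemma dyadic_part_eventually_0:
  fixes x :: "'h::real_normed_vector"
  shows "\<exists>N. \<forall>n\<ge>N. dyadic_part n x = 0 \<and> (\<Sum>k<n. dyadic_part k x) = x"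
proof -
  obtain N where N: "2 * norm x < 2 ^ N"
    using real_arch_pow[of 2 "2 * norm x"] by auto
  \<comment> \<open>The sum over indices below \<open>n\<close> telescopes to the ramp of index
    \<open>n - 1\<close>, hence the shift to \<open>Suc N\<close>.\<close>
  have "dyadic_part n x = 0 \<and> (\<Sum>k<n. dyadic_part k x) = x" if n: "Suc N \<le> n" for n
  proof -
    have le: "2 * norm x \<le> 2 ^ j" if "N \<le> j" for j
      using N power_increasing[OF that, of "2 :: real"] by linarith
    obtain l where l: "n = Suc l" "N \<le> l" using n by (cases n) auto
    have "norm x \<le> 2 ^ l" using le[OF l(2)] norm_ge_zero[of x] by linarith
    then have "(\<Sum>k<n. dyadic_bump k (norm x)) = 1"
      unfolding l(1) sum_dyadic_bump by (rule cutoff_eq_1)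
    then have "(\<Sum>k<n. dyadic_part k x) = x"
      by (simp add: dyadic_part_def scaleR_sum_left[symmetric])
    moreover have "dyadic_part n x = 0"
      using le[of n] n by (simp add: dyadic_part_def dyadic_bump_eq_0)
    ultimately show ?thesis by blast
  qed
  then show ?thesis by blast
qed

lemma dyadic_part_support:
  fixes x y :: "'h::real_normed_vector"
  obtains S where "finite S" "card S \<le> 4"
    "\<And>k. k \<notin> S \<Longrightarrow> dyadic_part k x = 0 \<and> dyadic_part k y = 0"
proof -
  obtain p q where "{k. dyadic_bump k (norm x) \<noteq> 0} \<subseteq> {p, Suc p}"
    "{k. dyadic_bump k (norm y) \<noteq> 0} \<subseteq> {q, Suc q}"
    using dyadic_bump_support by meson
  moreover have "card {p, Suc p, q, Suc q} \<le> 4"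
    by (auto simp: card_insert_if)
  ultimately show ?thesis
    by (intro that[of "{p, Suc p, q, Suc q}"]) (auto simp: dyadic_part_def)
qed

lemma finite_dyadic_part_image:
  fixes M :: "'h::real_normed_vector set"
  assumes "locally_finite M"
  shows "finite (dyadic_part k ` M)"
proof (cases "M = {}")
  case False
  then obtain a where a: "a \<in> M" by auto
  \<comment> \<open>The radius is chosen so that points of \<open>M\<close> outside this ball have
    norm at least \<open>2 ^ Suc k\<close>, where the part vanishes.\<close>
  let ?B = "cball a (norm a + 2 ^ Suc k) \<inter> M"
  have "dyadic_part k x = 0" if "x \<in> M" "x \<notin> ?B" for x
  proof -
    have "2 ^ Suc k \<le> norm x"
      using that norm_triangle_ineq4[of a x] by (auto simp: dist_norm not_le)
    then show ?thesis by (simp add: dyadic_part_def dyadic_bump_eq_0)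
  qed
  then have "dyadic_part k ` M \<subseteq> insert 0 (dyadic_part k ` ?B)" by blast
  moreover have "finite ?B" using assms a by (auto simp: locally_finite_def)
  ultimately show ?thesis by (meson finite.insertI finite_imageI finite_subset)
qed simp

section \<open>Choosing the maps shell by shell\<close>

text \<open>Although \<open>M\<close> may be infinite, each stage takes finitely many values on it,
  and so does each dyadic part. The differences therefore form finitely many pairs
  \<open>(u, z)\<close>, to which the finite Dvoretzky theorem applies with the earlier differences
  as shifts.\<close>

lemma embedding_sequence:
  fixes M :: "'h::real_inner set"
  assumes M: "locally_finite M"
    and inf: "\<not> finite_dimensional (UNIV :: 'x::real_normed_vector set)"
  obtains f :: "nat \<Rightarrow> 'h \<Rightarrow> 'x::real_normed_vector"
  where "\<And>x. f 0 x = 0"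
    and "\<And>n x. dyadic_part n x = 0 \<Longrightarrow> f (Suc n) x = f n x"
    and "\<And>n x y. x \<in> M \<Longrightarrow> y \<in> M \<Longrightarrow>
      norm ((f (Suc n) x - f (Suc n) y) - (f n x - f n y)) \<le> 2 * norm (dyadic_part n x - dyadic_part n y)"
    and "\<And>n x y. x \<in> M \<Longrightarrow> y \<in> M \<Longrightarrow>
      norm (dyadic_part n x - dyadic_part n y) / 2 \<le> norm (f (Suc n) x - f (Suc n) y)"
proof -
  define P where "P n f \<longleftrightarrow> finite (f ` M) \<and> (n = 0 \<longrightarrow> (\<forall>x. f x = 0))" for n :: nat and f :: "'h \<Rightarrow> 'x"
  define Q where "Q n f g \<longleftrightarrow> (\<forall>x. dyadic_part n x = 0 \<longrightarrow> g x = f x) \<and>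
    (\<forall>x\<in>M. \<forall>y\<in>M. norm ((g x - g y) - (f x - f y)) \<le> 2 * norm (dyadic_part n x - dyadic_part n y)
      \<and> norm (dyadic_part n x - dyadic_part n y) / 2 \<le> norm (g x - g y))" for n and f g :: "'h \<Rightarrow> 'x"
  have "\<exists>f. \<forall>n. P n (f n) \<and> Q n (f n) (f (Suc n))"
  proof (rule dependent_nat_choice)
    show "\<exists>f. P 0 f"
      by (rule exI[of _ "\<lambda>_. 0"]) (auto simp: P_def image_constant_conv)
  next
    fix f n assume "P n f"
    then have fin: "finite (f ` M)" by (simp add: P_def)
    let ?d = "dyadic_part n :: 'h \<Rightarrow> 'h"
    let ?S = "(\<lambda>((a, b), (z, w)). (a - b, z - w)) ` ((f ` M \<times> f ` M) \<times> (?d ` M \<times> ?d ` M))"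
    have "finite ((f ` M \<times> f ` M) \<times> (?d ` M \<times> ?d ` M))"
      by (intro finite_cartesian_product fin finite_dyadic_part_image M)
    then have "finite ?S" by (rule finite_imageI)
    from finite_Dvoretzky[OF inf this] obtain T :: "'h \<Rightarrow> 'x"
      where T: "linear T" "\<forall>(u, z)\<in>?S. norm (T z) \<le> 2 * norm z \<and> norm z / 2 \<le> norm (u + T z)"
      by blast
    define g where "g x = f x + T (?d x)" for x
    have "g ` M \<subseteq> (\<lambda>(a, z). a + T z) ` (f ` M \<times> ?d ` M)"
      by (auto simp: g_def)
    then have "finite (g ` M)"
      using fin finite_dyadic_part_image[OF M, of n] by (meson finite_SigmaI finite_imageI finite_subset)
    moreover have "norm ((g x - g y) - (f x - f y)) \<le> 2 * norm (?d x - ?d y)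
      \<and> norm (?d x - ?d y) / 2 \<le> norm (g x - g y)" if "x \<in> M" "y \<in> M" for x y
    proof -
      have "(f x - f y, ?d x - ?d y) \<in> ?S"
        using that by (intro image_eqI[of _ _ "((f x, f y), (?d x, ?d y))"]) auto
      then have "norm (T (?d x - ?d y)) \<le> 2 * norm (?d x - ?d y)
        \<and> norm (?d x - ?d y) / 2 \<le> norm ((f x - f y) + T (?d x - ?d y))"
        using T(2) by blast
      moreover have "g x - g y = (f x - f y) + T (?d x - ?d y)"
        by (simp add: g_def linear_diff[OF T(1)])
      ultimately show ?thesis by simp
    qed
    moreover have "g x = f x" if "?d x = 0" for x
      using that by (simp add: g_def linear_0[OF T(1)])
    ultimately show "\<exists>g. P (Suc n) g \<and> Q n f g"
      by (intro exI[of _ g]) (auto simp: P_def Q_def)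
  qed
  then obtain f where "\<And>n. P n (f n)" "\<And>n. Q n (f n) (f (Suc n))" by blast
  then show ?thesis by (intro that[of f]) (auto simp: P_def Q_def)
qed

text \<open>The sequence changes only at indices in \<open>S\<close>, and each change costs a factor
  of at most 5.\<close>

lemma lower_bound_propagates:
  fixes s :: "nat \<Rightarrow> 'a::real_normed_vector"
  assumes "finite S"
    and eq: "\<And>n. n \<notin> S \<Longrightarrow> s (Suc n) = s n"
    and step: "\<And>n. norm (s n) \<le> 5 * norm (s (Suc n))"
  shows "norm (s m) \<le> 5 ^ card S * norm (s (m + d))"
proof -
  have "norm (s m) \<le> 5 ^ card (S \<inter> {m..<m + d}) * norm (s (m + d))"
  proof (induction d)
    case (Suc d)
    show ?case
    proof (cases "m + d \<in> S")
      case True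
      then have "S \<inter> {m..<m + Suc d} = insert (m + d) (S \<inter> {m..<m + d})" by auto
      then have "card (S \<inter> {m..<m + Suc d}) = Suc (card (S \<inter> {m..<m + d}))"
        using \<open>finite S\<close> by simp
      moreover have "norm (s m) \<le> 5 ^ card (S \<inter> {m..<m + d}) * (5 * norm (s (Suc (m + d))))"
        by (rule order_trans[OF Suc.IH], intro mult_left_mono step) auto
      ultimately show ?thesis by (simp add: mult_ac)
    next
      case False
      then have "S \<inter> {m..<m + Suc d} = S \<inter> {m..<m + d}" by (auto simp: less_Suc_eq)
      then show ?thesis using Suc.IH eq[OF False] by simp
    qed
  qed simp
  also have "\<dots> \<le> 5 ^ card S * norm (s (m + d))"
    using \<open>finite S\<close> by (intro mult_right_mono power_increasing card_mono) auto
  finally show ?thesis .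
qed

lemma lipschitz_embedding_onI:
  fixes f :: "'a::real_normed_vector \<Rightarrow> 'b::real_normed_vector"
  assumes "0 \<le> L" "0 \<le> L'"
    and "\<And>x y. x \<in> A \<Longrightarrow> y \<in> A \<Longrightarrow> norm (f x - f y) \<le> L * norm (x - y)"
    and low: "\<And>x y. x \<in> A \<Longrightarrow> y \<in> A \<Longrightarrow> norm (x - y) \<le> L' * norm (f x - f y)"
  shows "lipschitz_embedding_on A f"
  unfolding lipschitz_embedding_on_def
proof (intro conjI exI)
  show "L-lipschitz_on A f"
    using assms by (intro lipschitz_onI) (auto simp: dist_norm)
  show inj: "inj_on f A"
  proof (rule inj_onI)
    fix x y assume "x \<in> A" "y \<in> A" "f x = f y"
    then show "x = y" using low[of x y] by simp
  qed
  show "L'-lipschitz_on (f ` A) (inv_into A f)"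
    using assms inj by (intro lipschitz_onI) (auto simp: dist_norm)
qed

theorem theorem4p3:
  fixes M :: "'h::{real_inner,complete_space} set"
  assumes "locally_finite M"
    and "\<not> finite_dimensional (UNIV :: 'x::banach set)"
  shows "\<exists>f :: 'h \<Rightarrow> 'x. lipschitz_embedding_on M f"
proof -
  from embedding_sequence[OF assms] obtain f :: "nat \<Rightarrow> 'h \<Rightarrow> 'x"
    where f0: "\<And>x. f 0 x = 0"
      and stat: "\<And>n x. dyadic_part n x = 0 \<Longrightarrow> f (Suc n) x = f n x"
      and up: "\<And>n x y. x \<in> M \<Longrightarrow> y \<in> M \<Longrightarrow>
        norm ((f (Suc n) x - f (Suc n) y) - (f n x - f n y)) \<le> 2 * norm (dyadic_part n x - dyadic_part n y)"
      and low: "\<And>n x y. x \<in> M \<Longrightarrow> y \<in> M \<Longrightarrow>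
        norm (dyadic_part n x - dyadic_part n y) / 2 \<le> norm (f (Suc n) x - f (Suc n) y)"
    by blast
  obtain N where N: "\<And>x n. N x \<le> n \<Longrightarrow> dyadic_part n x = 0 \<and> (\<Sum>k<n. dyadic_part k x) = (x :: 'h)"
    using dyadic_part_eventually_0 by metis
  \<comment> \<open>The sequence is stationary from \<open>N x\<close> on, so this is its limit at
    \<open>x\<close>.\<close>
  define F where "F x = f (N x) x" for x
  have F: "F x = f n x" if "N x \<le> n" for x n
    using that by (induction n rule: dec_induct) (auto simp: F_def stat N)
  \<comment> \<open>\<open>56 = 2 * 4 * 7\<close>: the bound for the maps, the number of active
    shells, and the Lipschitz constant of a part. \<open>5000 = 4 * 2 * 5 ^ 4\<close>: the share of
    the largest part, its lower bound, and the propagation cost.\<close>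
  have "norm (F x - F y) \<le> 56 * norm (x - y) \<and> norm (x - y) \<le> 5000 * norm (F x - F y)"
    if xy: "x \<in> M" "y \<in> M" for x y
  proof -
    define n where "n = max (N x) (N y)"
    define w where "w k = dyadic_part k x - dyadic_part k y" for k
    define s where "s k = f k x - f k y" for k
    have "F x = f n x" "F y = f n y" by (rule F, simp add: n_def)+
    then have Fs: "F x - F y = s n" by (simp add: s_def)
    have w_sum: "(\<Sum>k<n. w k) = x - y" by (simp add: w_def sum_subtractf N n_def)
    obtain S where S: "finite S" "card S \<le> 4" "\<And>k. k \<notin> S \<Longrightarrow> w k = 0"
      using dyadic_part_support[of x y] unfolding w_def by (metis diff_zero)
    have diff: "norm (s (Suc k) - s k) \<le> 2 * norm (w k)" for k
      using up[OF xy] by (simp add: s_def w_def)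
    have w_low: "norm (w k) / 2 \<le> norm (s (Suc k))" for k
      using low[OF xy] by (simp add: s_def w_def)
    have w_sum_norm: "(\<Sum>k<n. norm (w k)) \<le> real (card (S \<inter> {..<n})) * B"
      if "\<And>k. k \<in> S \<inter> {..<n} \<Longrightarrow> norm (w k) \<le> B" for B
    proof -
      have "(\<Sum>k<n. norm (w k)) = (\<Sum>k\<in>S \<inter> {..<n}. norm (w k))"
        using S by (intro sum.mono_neutral_right) auto
      also have "\<dots> \<le> real (card (S \<inter> {..<n})) * B"
        using that by (rule sum_bounded_above)
      finally show ?thesis .
    qed
    have card_le: "real (card (S \<inter> {..<n})) \<le> 4"
      using card_mono[of S "S \<inter> {..<n}"] S by simp
    have "norm (s n) \<le> (\<Sum>k<n. norm (s (Suc k) - s k))"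
      using sum_lessThan_telescope[of s n] norm_sum[of "\<lambda>k. s (Suc k) - s k" "{..<n}"]
      by (simp add: s_def f0)
    also have "\<dots> \<le> (\<Sum>k<n. 2 * norm (w k))" by (intro sum_mono diff)
    also have "\<dots> = 2 * (\<Sum>k<n. norm (w k))" by (simp add: sum_distrib_left)
    also have "\<dots> \<le> 2 * (4 * (7 * norm (x - y)))"
    proof -
      have "(\<Sum>k<n. norm (w k)) \<le> real (card (S \<inter> {..<n})) * (7 * norm (x - y))"
        by (rule w_sum_norm) (simp add: w_def dyadic_part_lipschitz)
      also have "\<dots> \<le> 4 * (7 * norm (x - y))"
        by (intro mult_right_mono card_le) auto
      finally show ?thesis by simp
    qed
    finally have upper: "norm (s n) \<le> 56 * norm (x - y)" by simp
    have "\<exists>k<n. norm (x - y) \<le> 4 * norm (w k)" if "x \<noteq> y"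
    proof (rule ccontr)
      assume "\<not> ?thesis"
      then have small: "\<And>k. k < n \<Longrightarrow> 4 * norm (w k) < norm (x - y)" by (auto simp: not_le)
      have ne: "S \<inter> {..<n} \<noteq> {}"
      proof
        assume "S \<inter> {..<n} = {}"
        then have "(\<Sum>k<n. w k) = 0" using S(3) by (intro sum.neutral) auto
        then show False using w_sum that by simp
      qed
      have "norm (x - y) \<le> (\<Sum>k<n. norm (w k))" unfolding w_sum[symmetric] by (rule norm_sum)
      also have "\<dots> = (\<Sum>k\<in>S \<inter> {..<n}. norm (w k))"
        using S by (intro sum.mono_neutral_right) auto
      also have "\<dots> < (\<Sum>k\<in>S \<inter> {..<n}. norm (x - y) / 4)"
      proof (rule sum_strict_mono)
        show "norm (w k) < norm (x - y) / 4" if "k \<in> S \<inter> {..<n}" for k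
          using small[of k] that by simp
      qed (use S(1) ne in auto)
      also have "\<dots> = real (card (S \<inter> {..<n})) * (norm (x - y) / 4)" by simp
      also have "\<dots> \<le> 4 * (norm (x - y) / 4)" by (intro mult_right_mono card_le) auto
      finally show False by simp
    qed
    then have "norm (x - y) \<le> 5000 * norm (s n)"
    proof (cases "x = y")
      case False
      with \<open>x \<noteq> y \<Longrightarrow> \<exists>k<n. norm (x - y) \<le> 4 * norm (w k)\<close>
      obtain k where k: "k < n" "norm (x - y) \<le> 4 * norm (w k)" by blast
      \<comment> \<open>The lower bound at stage \<open>j\<close> gives
        \<open>norm (w j) \<le> 2 * norm (s (Suc j))\<close>, and \<open>s j\<close> differs from
        \<open>s (Suc j)\<close> by at most twice \<open>norm (w j)\<close>: hence
        \<open>1 + 4 = 5\<close>.\<close>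
      have step: "norm (s j) \<le> 5 * norm (s (Suc j))" for j
        using diff[of j] w_low[of j] norm_triangle_ineq3[of "s (Suc j)" "s j"] by linarith
      have eq: "s (Suc j) = s j" if "j \<notin> S" for j
        using diff[of j] S(3)[OF that] by simp
      have "norm (s (Suc k)) \<le> 5 ^ card S * norm (s (Suc k + (n - Suc k)))"
        by (rule lower_bound_propagates[where s = s, OF S(1) eq step])
      also have "\<dots> \<le> 5 ^ 4 * norm (s n)"
      proof -
        have "(5 :: real) ^ card S \<le> 5 ^ 4" using S(2) by (intro power_increasing) auto
        then have "5 ^ card S * norm (s n) \<le> 5 ^ 4 * norm (s n)" by (intro mult_right_mono) auto
        then show ?thesis using k(1) by simp
      qed
      finally show ?thesis using k(2) w_low[of k] by simp
    qed simp
    with upper show ?thesis by (simp add: Fs)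
  qed
  then have "lipschitz_embedding_on M F"
    by (intro lipschitz_embedding_onI[of 56 5000]) auto
  then show ?thesis by blast
qed

end
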